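(* Let $m\ge1$ be an integer. The standard $m$-corotational harmonic map $U_m$ is nondegenerate. That is, all bounded maps in the kernel of $L_{U_m}$ are real linear combinations of $\{E_{kj},\tilde E_{\nu j},\tilde E_{mj}\}$ ($k=0,1,\dots,m$, $\nu=1,\dots,m-1$, $j=1,2$), where $$E_{k1}=\frac{r^{m-k}}{1+r^{2m}}(-\cos k\theta\,E_1+\sin k\theta\,E_2),\qquad E_{k2}=\frac{r^{m-k}}{1+r^{2m}}(\sin k\theta\,E_1+\cos k\theta\,E_2),\qquad k=0,1,\dots,m,$$ $$\tilde E_{\nu1}=\frac{r^{m+\nu}}{1+r^{2m}}(-\cos\nu\theta\,E_1-\sin\nu\theta\,E_2),\qquad \tilde E_{\nu2}=\frac{r^{m+\nu}}{1+r^{2m}}(-\sin\nu\theta\,E_1+\cos\nu\theta\,E_2),\qquad \nu=1,\dots,m-1,$$ $$\tilde E_{m1}=\begin{pmatrix}0\\[2pt] \dfrac{r^{2m}-1}{r^{2m}+1}\\[6pt] -\dfrac{2r^m\sin m\theta}{r^{2m}+1}\end{pmatrix},\qquad \tilde E_{m2}=\begin{pmatrix}\dfrac{r^{2m}-1}{r^{2m}+1}\\[6pt] 0\\[2pt] -\dfrac{2r^m\cos m\theta}{r^{2m}+1}\end{pmatrix}.$$ In particular, $\dim_{\mathbb R}\ker L_{U_m}=4m+2$.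
   Context: $(r,\theta)$ are polar coordinates on $\mathbb R^2=\mathbb C$, $z=re^{i\theta}=x+iy$. The standard $m$-corotational harmonic map $U_m:\mathbb R^2\to\mathbb S^2\subset\mathbb R^3$ is $$U_m(r,\theta)=\begin{pmatrix}\cos m\theta\sin Q_m(r)\\ \sin m\theta\sin Q_m(r)\\ \cos Q_m(r)\end{pmatrix}=\frac1{1+r^{2m}}\begin{pmatrix}2r^m\cos m\theta\\ 2r^m\sin m\theta\\ r^{2m}-1\end{pmatrix},\qquad Q_m(r)=\pi-2\arctan(r^m).$$ Also $$E_1=\begin{pmatrix}-\sin m\theta\\ \cos m\theta\\ 0\end{pmatrix},\qquad E_2=\begin{pmatrix}\cos m\theta\cos Q_m\\ \sin m\theta\cos Q_m\\ -\sin Q_m\end{pmatrix}.$$ For a map $u:\mathbb R^2\to\mathbb S^2$ satisfying $\Delta u+|\nabla u|^2u=0$ and a map $v:\mathbb R^2\to\mathbb R^3$ with $v\cdot u=0$ everywhere, $L_u[v]=\Delta v+|\nabla u|^2v+2(\nabla u\cdot\nabla v)u$, with $|\nabla u|^2=|u_x|^2+|u_y|^2$ and $\nabla u\cdot\nabla v=u_x\cdot v_x+u_y\cdot v_y$. The bounded kernel $\ker L_u$ is the real vector space of all $C^2$ maps $v:\mathbb C\to\mathbb R^3$ with $v\cdot u=0$ everywhere, $\sup_{z\in\mathbb C}(|v|+|\partial v|+|\partial^2v|)<\infty$, and $L_u[v]=0$. *)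

theory Defs
  imports "HOL-Analysis.Analysis" "HOL-Library.Function_Algebras"
begin

(* The pointwise real vector space structure on functions; together with
   Function_Algebras it makes span and dim available for spaces of maps. *)

instantiation "fun" :: (type, real_vector) real_vector
begin

definition scaleR_fun :: "real \<Rightarrow> ('a \<Rightarrow> 'b) \<Rightarrow> 'a \<Rightarrow> 'b"
  where "scaleR_fun c f = (\<lambda>x. c *\<^sub>R f x)"

instance
  by standard (auto simp: scaleR_fun_def fun_eq_iff scaleR_add_right scaleR_add_left)

end

type_synonym map3 = "complex \<Rightarrow> real^3"

definition dx :: "map3 \<Rightarrow> map3"
  where "dx v z = vector_derivative (\<lambda>t. v (z + of_real t)) (at 0)"

definition dy :: "map3 \<Rightarrow> map3"
  where "dy v z = vector_derivative (\<lambda>t. v (z + \<i> * of_real t)) (at 0)"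

definition C1 :: "map3 \<Rightarrow> bool"
  where "C1 v \<longleftrightarrow>
    v differentiable_on UNIV \<and> continuous_on UNIV (dx v) \<and> continuous_on UNIV (dy v)"

definition C2 :: "map3 \<Rightarrow> bool"
  where "C2 v \<longleftrightarrow> C1 v \<and> C1 (dx v) \<and> C1 (dy v)"

(* The product norm and inner product on pairs are Euclidean:
   |grad u|^2 = |u_x|^2 + |u_y|^2 and grad u . grad v = u_x . v_x + u_y . v_y. *)
definition grad :: "map3 \<Rightarrow> complex \<Rightarrow> (real^3) \<times> (real^3)"
  where "grad v z = (dx v z, dy v z)"

definition hess :: "map3 \<Rightarrow> complex \<Rightarrow> ((real^3) \<times> (real^3)) \<times> ((real^3) \<times> (real^3))"
  where "hess v z = (grad (dx v) z, grad (dy v) z)"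

definition laplacian :: "map3 \<Rightarrow> map3"
  where "laplacian v z = dx (dx v) z + dy (dy v) z"

definition L_op :: "map3 \<Rightarrow> map3 \<Rightarrow> map3"
  where "L_op u v z =
    laplacian v z + (norm (grad u z))\<^sup>2 *\<^sub>R v z + (2 * (grad u z \<bullet> grad v z)) *\<^sub>R u z"

definition bounded_kernel :: "map3 \<Rightarrow> map3 set"
  where "bounded_kernel u =
    {v. C2 v \<and> (\<forall>z. v z \<bullet> u z = 0) \<and>
        bdd_above (range (\<lambda>z. norm (v z) + norm (grad v z) + norm (hess v z))) \<and>
        (\<forall>z. L_op u v z = 0)}"

(* Since Arg 0 = 0 and 0 ^ 0 = 1, all maps below take at the origin the value by
   which their expressions in polar coordinates extend continuously. *)
definition of_polar :: "(real \<Rightarrow> real \<Rightarrow> real^3) \<Rightarrow> map3"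
  where "of_polar f z = f (cmod z) (Arg z)"

definition Q :: "nat \<Rightarrow> real \<Rightarrow> real"
  where "Q m r = pi - 2 * arctan (r ^ m)"

definition U :: "nat \<Rightarrow> map3"
  where "U m = of_polar (\<lambda>r \<theta>. vector
    [cos (m * \<theta>) * sin (Q m r), sin (m * \<theta>) * sin (Q m r), cos (Q m r)])"

definition E1 :: "nat \<Rightarrow> real \<Rightarrow> real^3"
  where "E1 m \<theta> = vector [- sin (m * \<theta>), cos (m * \<theta>), 0]"

definition E2 :: "nat \<Rightarrow> real \<Rightarrow> real \<Rightarrow> real^3"
  where "E2 m r \<theta> = vector
    [cos (m * \<theta>) * cos (Q m r), sin (m * \<theta>) * cos (Q m r), - sin (Q m r)]"

definition Ek1 :: "nat \<Rightarrow> nat \<Rightarrow> map3"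
  where "Ek1 m k = of_polar (\<lambda>r \<theta>. (r ^ (m - k) / (1 + r ^ (2 * m))) *\<^sub>R
    (- cos (k * \<theta>) *\<^sub>R E1 m \<theta> + sin (k * \<theta>) *\<^sub>R E2 m r \<theta>))"

definition Ek2 :: "nat \<Rightarrow> nat \<Rightarrow> map3"
  where "Ek2 m k = of_polar (\<lambda>r \<theta>. (r ^ (m - k) / (1 + r ^ (2 * m))) *\<^sub>R
    (sin (k * \<theta>) *\<^sub>R E1 m \<theta> + cos (k * \<theta>) *\<^sub>R E2 m r \<theta>))"

definition Etilde1 :: "nat \<Rightarrow> nat \<Rightarrow> map3"
  where "Etilde1 m \<nu> = of_polar (\<lambda>r \<theta>. (r ^ (m + \<nu>) / (1 + r ^ (2 * m))) *\<^sub>R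
    (- cos (\<nu> * \<theta>) *\<^sub>R E1 m \<theta> - sin (\<nu> * \<theta>) *\<^sub>R E2 m r \<theta>))"

definition Etilde2 :: "nat \<Rightarrow> nat \<Rightarrow> map3"
  where "Etilde2 m \<nu> = of_polar (\<lambda>r \<theta>. (r ^ (m + \<nu>) / (1 + r ^ (2 * m))) *\<^sub>R
    (- sin (\<nu> * \<theta>) *\<^sub>R E1 m \<theta> + cos (\<nu> * \<theta>) *\<^sub>R E2 m r \<theta>))"

definition Etilde_m1 :: "nat \<Rightarrow> map3"
  where "Etilde_m1 m = of_polar (\<lambda>r \<theta>. vector
    [0, (r ^ (2 * m) - 1) / (r ^ (2 * m) + 1), - (2 * r ^ m * sin (m * \<theta>)) / (r ^ (2 * m) + 1)])"

definition Etilde_m2 :: "nat \<Rightarrow> map3"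
  where "Etilde_m2 m = of_polar (\<lambda>r \<theta>. vector
    [(r ^ (2 * m) - 1) / (r ^ (2 * m) + 1), 0, - (2 * r ^ m * cos (m * \<theta>)) / (r ^ (2 * m) + 1)])"

definition kernel_maps :: "nat \<Rightarrow> map3 set"
  where "kernel_maps m =
    Ek1 m ` {0..m} \<union> Ek2 m ` {0..m} \<union> Etilde1 m ` {1..<m} \<union> Etilde2 m ` {1..<m} \<union>
    {Etilde_m1 m, Etilde_m2 m}"

lemma U_rational:
  "U m = of_polar (\<lambda>r \<theta>. (1 / (1 + r ^ (2 * m))) *\<^sub>R vector
    [2 * r ^ m * cos (m * \<theta>), 2 * r ^ m * sin (m * \<theta>), r ^ (2 * m) - 1])"
proof -
  have pos: "1 + x\<^sup>2 > 0" for x :: real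
    by (simp add: add_pos_nonneg)
  have s: "sin (2 * arctan x) = 2 * x / (1 + x\<^sup>2)" for x :: real
    using pos[of x] unfolding sin_double sin_arctan cos_arctan by simp
  have c: "cos (2 * arctan x) = (1 - x\<^sup>2) / (1 + x\<^sup>2)" for x :: real
    using pos[of x] by (simp add: cos_double sin_arctan cos_arctan power_divide diff_divide_distrib)
  have "sin (Q m r) = 2 * r ^ m / (1 + r ^ (2 * m))"
    "cos (Q m r) = (r ^ (2 * m) - 1) / (1 + r ^ (2 * m))" for r
    using s[of "r ^ m"] c[of "r ^ m"]
    by (simp_all add: Q_def power_mult[symmetric] mult.commute minus_divide_left)
  then show ?thesis
    by (auto simp: U_def of_polar_def fun_eq_iff vec_eq_iff forall_3)
qed

lemma dx_dy_frechet:
  assumes "v differentiable_on UNIV"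
  shows "dx v z = frechet_derivative v (at z) 1" "dy v z = frechet_derivative v (at z) \<i>"
proof -
  let ?D = "frechet_derivative v (at z)"
  have D: "(v has_derivative ?D) (at z)"
    using assms by (simp add: differentiable_on_def frechet_derivative_works[symmetric])
  have lin: "linear ?D"
    using D by (rule has_derivative_linear)
  have *: "vector_derivative (\<lambda>t. v (z + e * of_real t)) (at 0) = ?D e" for e
  proof -
    have "((\<lambda>t::real. z + e * of_real t) has_derivative (\<lambda>t. e * of_real t)) (at 0)"
      by (auto intro!: derivative_eq_intros)
    then have "((\<lambda>t. v (z + e * of_real t)) has_derivative (\<lambda>t. ?D (e * of_real t))) (at (0::real))"
      using has_derivative_compose[of "\<lambda>t::real. z + e * of_real t" _ 0 UNIV v ?D] D by simp
    moreover have "?D (e * of_real t) = t *\<^sub>R ?D e" for t :: real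
      using linear_scale[OF lin, of t e] by (simp add: scaleR_conv_of_real mult.commute)
    ultimately show ?thesis
      by (simp add: has_vector_derivative_def vector_derivative_at)
  qed
  show "dx v z = ?D 1" "dy v z = ?D \<i>"
    using *[of 1] *[of \<i>] by (simp_all add: dx_def dy_def)
qed

lemma dx_dy_linear:
  assumes "v differentiable_on UNIV" "w differentiable_on UNIV"
  shows "dx (\<lambda>z. v z + w z) = (\<lambda>z. dx v z + dx w z)" "dy (\<lambda>z. v z + w z) = (\<lambda>z. dy v z + dy w z)"
    "dx (\<lambda>z. c *\<^sub>R v z) = (\<lambda>z. c *\<^sub>R dx v z)" "dy (\<lambda>z. c *\<^sub>R v z) = (\<lambda>z. c *\<^sub>R dy v z)"
proof -
  have D: "(v has_derivative frechet_derivative v (at z)) (at z)"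
    "(w has_derivative frechet_derivative w (at z)) (at z)" for z
    using assms by (simp_all add: differentiable_on_def frechet_derivative_works[symmetric])
  have A: "frechet_derivative (\<lambda>z. v z + w z) (at z) =
      (\<lambda>h. frechet_derivative v (at z) h + frechet_derivative w (at z) h)" for z
    using frechet_derivative_at[OF has_derivative_add[OF D]] by simp
  have S: "frechet_derivative (\<lambda>z. c *\<^sub>R v z) (at z) =
      (\<lambda>h. c *\<^sub>R frechet_derivative v (at z) h)" for z
    using frechet_derivative_at[OF has_derivative_scaleR_right[OF D(1)]] by simp
  have d: "(\<lambda>z. v z + w z) differentiable_on UNIV" "(\<lambda>z. c *\<^sub>R v z) differentiable_on UNIV"
    using assms D by (auto simp: differentiable_on_def intro: differentiable_add differentiableI[OF has_derivative_scaleR_right])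
  show "dx (\<lambda>z. v z + w z) = (\<lambda>z. dx v z + dx w z)" "dy (\<lambda>z. v z + w z) = (\<lambda>z. dy v z + dy w z)"
    "dx (\<lambda>z. c *\<^sub>R v z) = (\<lambda>z. c *\<^sub>R dx v z)" "dy (\<lambda>z. c *\<^sub>R v z) = (\<lambda>z. c *\<^sub>R dy v z)"
    by (simp_all add: fun_eq_iff dx_dy_frechet assms d A S)
qed

lemma C1_add: "C1 v \<Longrightarrow> C1 w \<Longrightarrow> C1 (\<lambda>z. v z + w z)"
  by (auto simp: C1_def dx_dy_linear intro: continuous_on_add differentiable_on_add)

lemma C1_scaleR: "C1 v \<Longrightarrow> C1 (\<lambda>z. c *\<^sub>R v z)"
  by (auto simp: C1_def dx_dy_linear intro!: continuous_intros)

lemma subspace_bounded_kernel: "subspace (bounded_kernel u)"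
proof -
  have zero: "dx (\<lambda>z. 0) = (\<lambda>z. 0)" "dy (\<lambda>z. 0) = (\<lambda>z. 0)"
    by (simp_all add: fun_eq_iff dx_def dy_def)
  have zeroC1: "C1 (\<lambda>z. 0)"
    by (simp add: C1_def zero)
  have "(\<lambda>z. 0) \<in> bounded_kernel u"
    by (auto simp: bounded_kernel_def C2_def zeroC1 zero grad_def hess_def L_op_def laplacian_def
        inner_Pair)
  moreover have "(\<lambda>z. v z + w z) \<in> bounded_kernel u"
    if v: "v \<in> bounded_kernel u" and w: "w \<in> bounded_kernel u" for v w
  proof -
    have C: "C1 v" "C1 w" "C1 (dx v)" "C1 (dx w)" "C1 (dy v)" "C1 (dy w)"
      using v w by (auto simp: bounded_kernel_def C2_def)
    then have d: "v differentiable_on UNIV" "w differentiable_on UNIV"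
      "dx v differentiable_on UNIV" "dx w differentiable_on UNIV"
      "dy v differentiable_on UNIV" "dy w differentiable_on UNIV"
      by (auto simp: C1_def)
    note lin = dx_dy_linear(1,2)[OF d(1,2)] dx_dy_linear(1,2)[OF d(3,4)] dx_dy_linear(1,2)[OF d(5,6)]
    have g: "grad (\<lambda>z. v z + w z) z = grad v z + grad w z"
      "hess (\<lambda>z. v z + w z) z = hess v z + hess w z" for z
      by (simp_all add: grad_def hess_def lin)
    have "L_op u (\<lambda>z. v z + w z) z = L_op u v z + L_op u w z" for z
      by (simp add: L_op_def laplacian_def lin g inner_add_right algebra_simps scaleR_add_left)
    moreover obtain a b where
      "norm (v z) + norm (grad v z) + norm (hess v z) \<le> a"
      "norm (w z) + norm (grad w z) + norm (hess w z) \<le> b" for z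
      using v w by (auto simp: bounded_kernel_def bdd_above_def)
    then have "norm (v z + w z) + norm (grad v z + grad w z) + norm (hess v z + hess w z) \<le> a + b" for z
      by (smt (verit) norm_triangle_ineq)
    then have "bdd_above (range (\<lambda>z. norm (v z + w z) + norm (grad v z + grad w z) + norm (hess v z + hess w z)))"
      by (intro bdd_aboveI2)
    ultimately show ?thesis
      using v w C by (simp add: bounded_kernel_def C2_def C1_add lin g inner_add_left)
  qed
  moreover have "(\<lambda>z. c *\<^sub>R v z) \<in> bounded_kernel u"
    if v: "v \<in> bounded_kernel u" for c v
  proof -
    have C: "C1 v" "C1 (dx v)" "C1 (dy v)"
      using v by (auto simp: bounded_kernel_def C2_def)
    then have d: "v differentiable_on UNIV" "dx v differentiable_on UNIV" "dy v differentiable_on UNIV"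
      by (auto simp: C1_def)
    note lin = dx_dy_linear(3,4)[OF d(1,1)] dx_dy_linear(3,4)[OF d(2,2)] dx_dy_linear(3,4)[OF d(3,3)]
    have g: "grad (\<lambda>z. c *\<^sub>R v z) z = c *\<^sub>R grad v z"
      "hess (\<lambda>z. c *\<^sub>R v z) z = c *\<^sub>R hess v z" for z
      by (simp_all add: grad_def hess_def lin)
    have "L_op u (\<lambda>z. c *\<^sub>R v z) z = c *\<^sub>R L_op u v z" for z
      by (simp add: L_op_def laplacian_def lin g algebra_simps)
    moreover obtain a where "norm (v z) + norm (grad v z) + norm (hess v z) \<le> a" for z
      using v by (auto simp: bounded_kernel_def bdd_above_def)
    then have "\<bar>c\<bar> * (norm (v z) + norm (grad v z) + norm (hess v z)) \<le> \<bar>c\<bar> * a" for z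
      by (intro mult_left_mono) auto
    then have "bdd_above (range (\<lambda>z. norm (c *\<^sub>R v z) + norm (c *\<^sub>R grad v z) + norm (c *\<^sub>R hess v z)))"
      by (intro bdd_aboveI2) (auto simp: distrib_left)
    ultimately show ?thesis
      using v C by (simp add: bounded_kernel_def C2_def C1_scaleR lin g)
  qed
  ultimately show ?thesis
    by (auto simp: subspace_def zero_fun_def plus_fun_def scaleR_fun_def)
qed

end

theory Submission
  imports Defs "HOL-Complex_Analysis.Complex_Analysis"
begin

text \<open>
  The map \<open>U m\<close> is \<open>stereo (w z)\<close> with \<open>w = z\<^sup>m\<close> and \<open>stereo\<close> the inverse stereographic projection. A tangential
  field \<open>v\<close> along it has the complex coordinate \<open>\<phi> = n(w) \<cdot> v\<close>, where \<open>n(w) = (1 - w\<^sup>2, \<i> (1 + w\<^sup>2), 2w)\<close> is a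
  null vector orthogonal to \<open>stereo w\<close> (\<open>null_form\<close>, with inverse \<open>tangent_lift\<close>). Because \<open>n\<close> is
  holomorphic, \<open>G = (\<partial>\<^sub>x + \<i> \<partial>\<^sub>y) \<phi> = n \<cdot> (v\<^sub>x + \<i> v\<^sub>y)\<close>, and a computation gives (\<open>dbar_equation\<close>), with \<open>w\<^sup>*\<close> the
  conjugate of \<open>w\<close>,

  \<open>(\<partial>\<^sub>x - \<i> \<partial>\<^sub>y) G = (4 w' w\<^sup>* / (1 + \<bar>w\<bar>\<^sup>2)) G + n \<cdot> L[v]\<close>.

  The normal component of \<open>L[v]\<close> always vanishes (\<open>L_op_tangent\<close>), so \<open>L[v] = 0\<close> is the case \<open>n \<cdot> L[v] = 0\<close> of this
  equation, and then the conjugate of \<open>G\<close> divided by \<open>(1 + \<bar>w\<bar>\<^sup>2)\<^sup>2\<close> is entire.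

  If the gradient of \<open>v\<close> is bounded, that entire function is \<open>O(1 / (1 + \<bar>w\<bar>\<^sup>2))\<close>, hence zero by Liouville's theorem.
  So \<open>\<phi>\<close> is entire; if \<open>v\<close> is bounded, then \<open>\<phi> = O(1 + \<bar>w\<bar>\<^sup>2)\<close>, and \<open>\<phi>\<close> is a polynomial of degree at most \<open>2m\<close>
  (\<open>kernel_eq_tangent_field\<close>). Conversely each such polynomial has \<open>G = 0\<close>, hence solves the equation, and the components of
  its field are polynomials in the bounded functions \<open>z\<^sup>a (z\<^sup>*)\<^sup>b / (1 + \<bar>w\<bar>\<^sup>2)\<close>, \<open>a + b \<le> 2m\<close>, an algebra closed under
  differentiation; so the field and its derivatives are bounded (\<open>tangent_field_in_kernel\<close>). The kernel is thus isomorphic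
  to the complex polynomials of degree at most \<open>2m\<close>, of real dimension \<open>4m + 2\<close>.

  In this coordinate \<open>E\<^sub>k\<^sub>1\<close>, \<open>E\<^sub>k\<^sub>2\<close> are \<open>- \<i> z\<^sup>j\<close>, \<open>- z\<^sup>j\<close> with \<open>j = m - k\<close>, the maps with a tilde and index \<open>\<nu> < m\<close> are the
  same with \<open>j = m + \<nu>\<close>, and the last two are \<open>\<i> (w\<^sup>2 - 1)\<close> and \<open>- (w\<^sup>2 + 1)\<close>, so the listed maps
  span the kernel (\<open>monomial_fields_subset_span\<close>).
\<close>

section \<open>Symmetry of second derivatives\<close>

text \<open>The second difference of \<open>f\<close> in the directions \<open>a\<close>, \<open>b\<close> is symmetric in them. The mean value theorem in
  the direction \<open>a\<close> shows that, divided by \<open>h\<^sup>2\<close>, it tends to the derivative in direction \<open>b\<close> of the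
  directional derivative along \<open>a\<close>; no continuity of second derivatives is needed.\<close>

lemma second_difference:
  fixes f :: "'a::real_normed_vector \<Rightarrow> real"
  assumes f: "\<And>x. (f has_derivative f' x) (at x)"
    and g: "((\<lambda>x. f' x a) has_derivative g) (at x)"
    and e: "e > 0"
  shows "\<exists>d>0. \<forall>h. 0 < h \<and> h < d \<longrightarrow>
    \<bar>f (x + h *\<^sub>R a + h *\<^sub>R b) - f (x + h *\<^sub>R a) - f (x + h *\<^sub>R b) + f x - h\<^sup>2 * g b\<bar> \<le> e * h\<^sup>2"
proof -
  define N where "N = norm a + norm b + 1"
  have N: "N > 0" by (simp add: N_def add_nonneg_pos)
  define e' where "e' = e / (2 * N)"
  have e': "e' > 0" using e N by (simp add: e'_def)
  obtain d where d: "d > 0"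
    "\<And>y. norm (y - x) < d \<Longrightarrow> \<bar>f' y a - f' x a - g (y - x)\<bar> \<le> e' * norm (y - x)"
    using g e' unfolding has_derivative_at_alt by (metis real_norm_def)
  have lin: "linear g"
    using g by (rule has_derivative_linear)
  show ?thesis
  proof (intro exI conjI allI impI)
    show "d / N > 0" using d N by simp
    fix h :: real assume h: "0 < h \<and> h < d / N"
    then have hN: "h * N < d" using N by (simp add: field_simps)
    define p where "p t = f (x + t *\<^sub>R a + h *\<^sub>R b) - f (x + t *\<^sub>R a)" for t
    have aux: "((\<lambda>t. f (y + t *\<^sub>R a)) has_real_derivative f' (y + t *\<^sub>R a) a) (at t)" for y t
    proof -
      have "((\<lambda>t. f (y + t *\<^sub>R a)) has_derivative (\<lambda>s. f' (y + t *\<^sub>R a) (s *\<^sub>R a))) (at t)"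
        by (rule has_derivative_compose[OF _ f]) (auto intro!: derivative_eq_intros)
      moreover have "f' (y + t *\<^sub>R a) (s *\<^sub>R a) = f' (y + t *\<^sub>R a) a * s" for s
        using linear_scale[OF has_derivative_linear[OF f]] by simp
      ultimately show ?thesis by (simp add: has_field_derivative_def)
    qed
    have p: "(p has_real_derivative (f' (x + t *\<^sub>R a + h *\<^sub>R b) a - f' (x + t *\<^sub>R a) a)) (at t)" for t
      unfolding p_def using DERIV_diff[OF aux[of "x + h *\<^sub>R b" t] aux[of x t]]
      by (simp add: ac_simps)
    obtain t where t: "0 < t" "t < h"
      "p h - p 0 = h * (f' (x + t *\<^sub>R a + h *\<^sub>R b) a - f' (x + t *\<^sub>R a) a)"
      using MVT2[of 0 h p "\<lambda>t. f' (x + t *\<^sub>R a + h *\<^sub>R b) a - f' (x + t *\<^sub>R a) a"] h p by auto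
    \<comment> \<open>Both increments have norm at most \<open>h * N\<close>; hence the factor \<open>2 * N\<close> in \<open>e'\<close>.\<close>
    have n1: "norm (t *\<^sub>R a + h *\<^sub>R b) \<le> h * N" and n2: "norm (t *\<^sub>R a) \<le> h * N"
    proof -
      have "norm (t *\<^sub>R a) \<le> h * norm a" "norm (h *\<^sub>R b) = h * norm b"
        using t h by (auto intro: mult_right_mono)
      then show "norm (t *\<^sub>R a + h *\<^sub>R b) \<le> h * N" "norm (t *\<^sub>R a) \<le> h * N"
        using norm_triangle_ineq[of "t *\<^sub>R a" "h *\<^sub>R b"] h
        by (auto simp: N_def algebra_simps intro: order_trans add_nonneg_nonneg)
    qed
    have "\<bar>f' (x + t *\<^sub>R a + h *\<^sub>R b) a - f' x a - g (t *\<^sub>R a + h *\<^sub>R b)\<bar> \<le> e' * (h * N)"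
      using d(2)[of "x + t *\<^sub>R a + h *\<^sub>R b"] n1 hN e'
      by (smt (verit) add.assoc add_diff_cancel_left' mult_left_mono)
    moreover have "\<bar>f' (x + t *\<^sub>R a) a - f' x a - g (t *\<^sub>R a)\<bar> \<le> e' * (h * N)"
      using d(2)[of "x + t *\<^sub>R a"] n2 hN e'
      by (smt (verit) add_diff_cancel_left' mult_left_mono)
    moreover have "g (t *\<^sub>R a + h *\<^sub>R b) = g (t *\<^sub>R a) + h * g b"
      by (simp add: linear_add[OF lin] linear_scale[OF lin])
    ultimately have "\<bar>(f' (x + t *\<^sub>R a + h *\<^sub>R b) a - f' (x + t *\<^sub>R a) a) - h * g b\<bar> \<le> 2 * (e' * (h * N))"
      by linarith
    also have "2 * (e' * (h * N)) = e * h"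
      using N by (simp add: e'_def)
    finally have "h * \<bar>(f' (x + t *\<^sub>R a + h *\<^sub>R b) a - f' (x + t *\<^sub>R a) a) - h * g b\<bar> \<le> h * (e * h)"
      using h by (intro mult_left_mono) auto
    moreover have "h * \<bar>(f' (x + t *\<^sub>R a + h *\<^sub>R b) a - f' (x + t *\<^sub>R a) a) - h * g b\<bar>
        = \<bar>p h - p 0 - h\<^sup>2 * g b\<bar>"
      unfolding t(3) using h by (simp add: abs_mult[symmetric, of h, simplified] power2_eq_square
          abs_mult_pos' right_diff_distrib mult.assoc)
    ultimately show "\<bar>f (x + h *\<^sub>R a + h *\<^sub>R b) - f (x + h *\<^sub>R a) - f (x + h *\<^sub>R b) + f x - h\<^sup>2 * g b\<bar> \<le> e * h\<^sup>2"
      by (simp add: p_def power2_eq_square algebra_simps)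
  qed
qed

lemma second_derivative_symmetric:
  fixes f :: "'a::real_normed_vector \<Rightarrow> real"
  assumes f: "\<And>x. (f has_derivative f' x) (at x)"
    and ga: "((\<lambda>x. f' x a) has_derivative ga) (at x)"
    and gb: "((\<lambda>x. f' x b) has_derivative gb) (at x)"
  shows "ga b = gb a"
proof (rule ccontr)
  assume ne: "ga b \<noteq> gb a"
  define e where "e = \<bar>ga b - gb a\<bar> / 3"
  have e: "e > 0" using ne by (simp add: e_def)
  obtain d1 where d1: "d1 > 0" "\<And>h. 0 < h \<Longrightarrow> h < d1 \<Longrightarrow>
    \<bar>f (x + h *\<^sub>R a + h *\<^sub>R b) - f (x + h *\<^sub>R a) - f (x + h *\<^sub>R b) + f x - h\<^sup>2 * ga b\<bar> \<le> e * h\<^sup>2"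
    using second_difference[OF f ga e, of b] by blast
  obtain d2 where d2: "d2 > 0" "\<And>h. 0 < h \<Longrightarrow> h < d2 \<Longrightarrow>
    \<bar>f (x + h *\<^sub>R b + h *\<^sub>R a) - f (x + h *\<^sub>R b) - f (x + h *\<^sub>R a) + f x - h\<^sup>2 * gb a\<bar> \<le> e * h\<^sup>2"
    using second_difference[OF f gb e, of a] by blast
  define h where "h = min d1 d2 / 2"
  have h: "0 < h" "h < d1" "h < d2" using d1(1) d2(1) by (auto simp: h_def)
  have "\<bar>h\<^sup>2 * ga b - h\<^sup>2 * gb a\<bar> \<le> 2 * (e * h\<^sup>2)"
    using d1(2)[OF h(1,2)] d2(2)[OF h(1,3)] by (simp add: ac_simps)
  moreover have "\<bar>h\<^sup>2 * ga b - h\<^sup>2 * gb a\<bar> = 3 * e * h\<^sup>2"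
    by (simp add: e_def right_diff_distrib[symmetric] abs_mult)
  ultimately show False
    using e h by simp
qed

section \<open>Calculus of partial derivatives\<close>

text \<open>\<open>f\<close> is differentiable everywhere in the real sense, with partial derivatives \<open>p\<close> along \<open>1\<close> and \<open>q\<close> along
  \<open>\<i>\<close>. Values may lie in any normed space, so that the same rules serve real, complex and vector valued maps.\<close>

definition has_partials ::
    "(complex \<Rightarrow> 'a::real_normed_vector) \<Rightarrow> (complex \<Rightarrow> 'a) \<Rightarrow> (complex \<Rightarrow> 'a) \<Rightarrow> bool"
  where "has_partials f p q \<longleftrightarrow>
    (\<forall>z. (f has_derivative (\<lambda>h. Re h *\<^sub>R p z + Im h *\<^sub>R q z)) (at z))"

lemma has_partialsD:
  "has_partials f p q \<Longrightarrow> (f has_derivative (\<lambda>h. Re h *\<^sub>R p z + Im h *\<^sub>R q z)) (at z)"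
  by (simp add: has_partials_def)

lemma has_partials_unique:
  assumes "has_partials f p q" "has_partials f p' q'"
  shows "p = p'" "q = q'"
proof -
  have "(\<lambda>h. Re h *\<^sub>R p z + Im h *\<^sub>R q z) = (\<lambda>h. Re h *\<^sub>R p' z + Im h *\<^sub>R q' z)" for z
    using assms by (blast intro: has_derivative_unique has_partialsD)
  from fun_cong[OF this, of 1] fun_cong[OF this, of \<i>] show "p = p'" "q = q'"
    by auto
qed

lemma has_partials_add:
  assumes "has_partials f p q" "has_partials g p' q'"
  shows "has_partials (\<lambda>z. f z + g z) (\<lambda>z. p z + p' z) (\<lambda>z. q z + q' z)"
  unfolding has_partials_def
proof
  fix z
  show "((\<lambda>z. f z + g z) has_derivative (\<lambda>h. Re h *\<^sub>R (p z + p' z) + Im h *\<^sub>R (q z + q' z))) (at z)"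
    using has_derivative_add[OF has_partialsD[OF assms(1)] has_partialsD[OF assms(2)]]
    by (simp add: algebra_simps)
qed

lemma has_partials_const: "has_partials (\<lambda>z. c) (\<lambda>z. 0) (\<lambda>z. 0)"
  by (simp add: has_partials_def)

lemma has_partials_linear:
  assumes "bounded_linear T" "has_partials f p q"
  shows "has_partials (\<lambda>z. T (f z)) (\<lambda>z. T (p z)) (\<lambda>z. T (q z))"
  unfolding has_partials_def
proof
  fix z
  interpret T: bounded_linear T by fact
  show "((\<lambda>z. T (f z)) has_derivative (\<lambda>h. Re h *\<^sub>R T (p z) + Im h *\<^sub>R T (q z))) (at z)"
    using T.has_derivative[OF has_partialsD[OF assms(2)]] by (simp add: T.add T.scaleR)
qed

lemma has_partials_bilinear:
  assumes "bounded_bilinear B" "has_partials f p q" "has_partials g p' q'"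
  shows "has_partials (\<lambda>z. B (f z) (g z))
    (\<lambda>z. B (p z) (g z) + B (f z) (p' z)) (\<lambda>z. B (q z) (g z) + B (f z) (q' z))"
  unfolding has_partials_def
proof
  fix z
  interpret B: bounded_bilinear B by fact
  show "((\<lambda>z. B (f z) (g z)) has_derivative (\<lambda>h. Re h *\<^sub>R (B (p z) (g z) + B (f z) (p' z)) +
      Im h *\<^sub>R (B (q z) (g z) + B (f z) (q' z)))) (at z)"
    using B.FDERIV[OF has_partialsD[OF assms(2)] has_partialsD[OF assms(3)]]
    by (simp add: B.add_left B.add_right B.scaleR_left B.scaleR_right algebra_simps)
qed

lemmas has_partials_mult = has_partials_bilinear[OF bounded_bilinear_mult]
lemmas has_partials_inner = has_partials_bilinear[OF bounded_bilinear_inner]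

lemma has_partials_chain:
  fixes f :: "complex \<Rightarrow> complex"
  assumes "has_partials f p q" "\<And>z. (g has_field_derivative g' z) (at (f z))"
  shows "has_partials (\<lambda>z. g (f z)) (\<lambda>z. g' z * p z) (\<lambda>z. g' z * q z)"
  unfolding has_partials_def
proof
  fix z
  have "((\<lambda>z. g (f z)) has_derivative (\<lambda>h. g' z * (Re h *\<^sub>R p z + Im h *\<^sub>R q z))) (at z)"
    by (rule has_derivative_compose[OF has_partialsD[OF assms(1)]
          assms(2)[unfolded has_field_derivative_def]])
  then show "((\<lambda>z. g (f z)) has_derivative (\<lambda>h. Re h *\<^sub>R (g' z * p z) + Im h *\<^sub>R (g' z * q z))) (at z)"
    by (simp add: algebra_simps)
qed

lemma has_partials_holomorphic:
  assumes "\<And>z. (f has_field_derivative f' z) (at z)"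
  shows "has_partials f f' (\<lambda>z. \<i> * f' z)"
  unfolding has_partials_def
proof
  fix z
  have "(*) (f' z) = (\<lambda>h. Re h *\<^sub>R f' z + Im h *\<^sub>R (\<i> * f' z))"
    by (simp add: fun_eq_iff complex_eq_iff algebra_simps)
  then show "(f has_derivative (\<lambda>h. Re h *\<^sub>R f' z + Im h *\<^sub>R (\<i> * f' z))) (at z)"
    using assms[of z] by (simp add: has_field_derivative_def)
qed

text \<open>The Cauchy--Riemann equation \<open>f\<^sub>x + \<i> f\<^sub>y = 0\<close>.\<close>

lemma has_partials_imp_holomorphic:
  assumes "has_partials f p q" "\<And>z. p z + \<i> * q z = 0"
  shows "f holomorphic_on UNIV"
proof -
  have "(f has_field_derivative p z) (at z)" for z
  proof -
    have "q z = \<i> * p z"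
      using assms(2)[of z] by (simp add: complex_eq_iff)
    then have "Re h *\<^sub>R p z + Im h *\<^sub>R q z = p z * h" for h
      by (simp add: complex_eq_iff algebra_simps)
    then show ?thesis
      using has_partialsD[OF assms(1), of z] by (simp add: has_field_derivative_def)
  qed
  then show ?thesis
    by (auto simp: holomorphic_on_def field_differentiable_def intro: has_field_derivative_at_within)
qed

lemma has_partials_dx_dy:
  assumes "v differentiable_on UNIV"
  shows "has_partials v (dx v) (dy v)"
  unfolding has_partials_def
proof
  fix z
  have D: "(v has_derivative frechet_derivative v (at z)) (at z)"
    using assms by (simp add: differentiable_on_def frechet_derivative_works[symmetric])
  have "frechet_derivative v (at z) h = Re h *\<^sub>R dx v z + Im h *\<^sub>R dy v z" for h
  proof -
    have "frechet_derivative v (at z) (Re h *\<^sub>R 1 + Im h *\<^sub>R \<i>) = Re h *\<^sub>R dx v z + Im h *\<^sub>R dy v z"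
      unfolding dx_dy_frechet[OF assms]
      by (simp only: linear_add[OF has_derivative_linear[OF D]] linear_scale[OF has_derivative_linear[OF D]])
    moreover have "Re h *\<^sub>R 1 + Im h *\<^sub>R \<i> = h"
      by (simp add: complex_eq_iff)
    ultimately show ?thesis by simp
  qed
  then show "(v has_derivative (\<lambda>h. Re h *\<^sub>R dx v z + Im h *\<^sub>R dy v z)) (at z)"
    using D by (metis (no_types, lifting) ext)
qed

lemma has_partials_imp_dx_dy:
  assumes "has_partials v p q"
  shows "v differentiable_on UNIV" "dx v = p" "dy v = q"
proof -
  show d: "v differentiable_on UNIV"
    using has_partialsD[OF assms] by (auto simp: differentiable_on_def differentiable_def)
  from has_partials_unique[OF has_partials_dx_dy[OF d] assms] show "dx v = p" "dy v = q" .
qed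

lemma dx_dy_commute:
  assumes "C2 v"
  shows "dx (dy v) = dy (dx v)"
proof
  fix z
  have h: "has_partials v (dx v) (dy v)" "has_partials (dx v) (dx (dx v)) (dy (dx v))"
    "has_partials (dy v) (dx (dy v)) (dy (dy v))"
    using assms by (auto simp: C2_def C1_def intro: has_partials_dx_dy)
  note l = bounded_linear_inner_left
  have "dx (dy v) z \<bullet> b = dy (dx v) z \<bullet> b" for b
    using second_derivative_symmetric[OF has_partialsD[OF has_partials_linear[OF l h(1)]], of \<i> b _ z 1]
      has_partialsD[OF has_partials_linear[OF l h(2)], of b z]
      has_partialsD[OF has_partials_linear[OF l h(3)], of b z]
    by force
  then show "dx (dy v) z = dy (dx v) z"
    by (metis inner_eq_zero_iff inner_diff_left eq_iff_diff_eq_0)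
qed

section \<open>An algebra of bounded functions closed under differentiation\<close>

text \<open>The complex algebra generated by the functions \<open>z^a (cnj z)^b / (1 + \<bar>z\<bar>^(2m))\<close> with \<open>a + b \<le> 2m\<close>. The generators are
  bounded, and their \<open>z\<close>- and conjugate \<open>z\<close>-derivatives are polynomials in the generators. Hence every member
  is bounded together with all its derivatives.\<close>

inductive_set alg :: "nat \<Rightarrow> (complex \<Rightarrow> complex) set" for m :: nat where
  base: "a + b \<le> 2 * m \<Longrightarrow> (\<lambda>z. z ^ a * cnj z ^ b / (1 + z ^ m * cnj z ^ m)) \<in> alg m"
| scale: "f \<in> alg m \<Longrightarrow> (\<lambda>z. c * f z) \<in> alg m"
| add: "f \<in> alg m \<Longrightarrow> g \<in> alg m \<Longrightarrow> (\<lambda>z. f z + g z) \<in> alg m"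
| mult: "f \<in> alg m \<Longrightarrow> g \<in> alg m \<Longrightarrow> (\<lambda>z. f z * g z) \<in> alg m"

lemma alg_diff: "f \<in> alg m \<Longrightarrow> g \<in> alg m \<Longrightarrow> (\<lambda>z. f z - g z) \<in> alg m"
  using alg.add[of f m "\<lambda>z. (-1) * g z"] alg.scale[of g m "-1"] by simp

lemma alg_denominator: "1 + z ^ m * cnj z ^ m = complex_of_real (1 + cmod z ^ (2 * m))"
proof -
  have "complex_of_real (cmod z ^ (2 * m)) = (z * cnj z) ^ m"
    by (simp add: power_mult complex_norm_square[symmetric])
  then show ?thesis by (simp add: power_mult_distrib)
qed

lemma alg_denominator_nz: "1 + z ^ m * cnj z ^ m \<noteq> 0"
proof -
  have "1 + cmod z ^ (2 * m) > 0" by (simp add: add_pos_nonneg)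
  then show ?thesis unfolding alg_denominator by (metis of_real_eq_0_iff less_irrefl)
qed

lemma alg_bounded:
  assumes "f \<in> alg m"
  shows "\<exists>B. \<forall>z. cmod (f z) \<le> B"
  using assms
proof induction
  case (base a b)
  have "cmod (z ^ a * cnj z ^ b / (1 + z ^ m * cnj z ^ m)) \<le> 1" for z
  proof -
    have pos: "1 + cmod z ^ (2 * m) > 0" by (simp add: add_pos_nonneg)
    have "cmod z ^ (a + b) \<le> 1 + cmod z ^ (2 * m)"
    proof (cases "cmod z \<le> 1")
      case True
      then have "cmod z ^ (a + b) \<le> 1" by (simp add: power_le_one)
      moreover have "0 \<le> cmod z ^ (2 * m)" by simp
      ultimately show ?thesis by linarith
    next
      case False
      then have "cmod z ^ (a + b) \<le> cmod z ^ (2 * m)"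
        using base by (intro power_increasing) auto
      then show ?thesis by simp
    qed
    then show ?thesis
      unfolding alg_denominator norm_divide norm_of_real using pos
      by (simp add: norm_mult norm_power power_add)
  qed
  then show ?case by blast
next
  case (scale f c)
  then obtain B where "cmod (f z) \<le> B" for z by blast
  then have "cmod (c * f z) \<le> cmod c * B" for z
    by (simp add: norm_mult mult_left_mono)
  then show ?case by blast
next
  case (add f g)
  then obtain A B where "cmod (f z) \<le> A" "cmod (g z) \<le> B" for z by blast
  then have "cmod (f z + g z) \<le> A + B" for z
    by (meson add_mono norm_triangle_le)
  then show ?case by blast
next
  case (mult f g)
  then obtain A B where AB: "cmod (f z) \<le> A" "cmod (g z) \<le> B" for z by blast
  have "cmod (f z * g z) \<le> A * B" for z
    unfolding norm_mult by (intro mult_mono AB order_trans[OF norm_ge_zero AB(1)]) auto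
  then show ?case by blast
qed

lemma alg_partials:
  assumes "f \<in> alg m"
  shows "\<exists>p\<in>alg m. \<exists>q\<in>alg m. has_partials f p q"
  using assms
proof induction
  case (base a b)
  let ?D = "\<lambda>z. 1 + z ^ m * cnj z ^ m"
  define t where "t = (\<lambda>a b z. z ^ a * cnj z ^ b / ?D z)"
  have t: "t a b \<in> alg m" if "a + b \<le> 2 * m" for a b
    unfolding t_def using that by (rule alg.base)
  \<comment> \<open>\<open>A\<close> and \<open>B\<close> are the derivatives with respect to \<open>z\<close> and \<open>cnj z\<close>. The truncated exponents \<open>a - 1\<close>, \<open>b - 1\<close>,
    \<open>m - 1\<close> do no harm, since they come with a factor \<open>a\<close>, \<open>b\<close>, \<open>m\<close>.\<close>
  define A where "A = (\<lambda>z. of_nat a * t (a - 1) b z - of_nat m * (t a b z * t (m - 1) m z))"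
  define B where "B = (\<lambda>z. of_nat b * t a (b - 1) z - of_nat m * (t a b z * t m (m - 1) z))"
  have "A \<in> alg m" "B \<in> alg m"
    unfolding A_def B_def using base by (intro alg_diff alg.scale alg.mult t; linarith)+
  then have mem: "(\<lambda>z. A z + B z) \<in> alg m" "(\<lambda>z. \<i> * (A z - B z)) \<in> alg m"
    by (auto intro: alg.add alg.scale alg_diff)
  have pow: "has_partials (\<lambda>z. z ^ n) (\<lambda>z. of_nat n * z ^ (n - 1)) (\<lambda>z. \<i> * (of_nat n * z ^ (n - 1)))" for n
    by (rule has_partials_holomorphic) (auto intro!: derivative_eq_intros)
  have cpow: "has_partials (\<lambda>z. cnj z ^ n) (\<lambda>z. of_nat n * cnj z ^ (n - 1)) (\<lambda>z. - \<i> * (of_nat n * cnj z ^ (n - 1)))" for n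
    using has_partials_linear[OF bounded_linear_cnj pow[of n]] by simp
  have inv: "has_partials (\<lambda>z. 1 / ?D z)
    (\<lambda>z. - 1 / (?D z)\<^sup>2 * (0 + (of_nat m * z ^ (m - 1) * cnj z ^ m + z ^ m * (of_nat m * cnj z ^ (m - 1)))))
    (\<lambda>z. - 1 / (?D z)\<^sup>2 * (0 + (\<i> * (of_nat m * z ^ (m - 1)) * cnj z ^ m + z ^ m * (- \<i> * (of_nat m * cnj z ^ (m - 1))))))"
    by (rule has_partials_chain[OF has_partials_add[OF has_partials_const has_partials_mult[OF pow cpow]]])
      (use alg_denominator_nz in \<open>auto intro!: derivative_eq_intros simp: power2_eq_square\<close>)
  have "has_partials (t a b) (\<lambda>z. A z + B z) (\<lambda>z. \<i> * (A z - B z))"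
  proof -
    note H = has_partials_mult[OF has_partials_mult[OF pow[of a] cpow[of b]] inv]
    have f: "(\<lambda>z. z ^ a * cnj z ^ b * (1 / ?D z)) = t a b"
      by (simp add: t_def)
    show ?thesis
      by (rule back_subst[of "\<lambda>p. has_partials _ p _", OF back_subst[of "has_partials _ _", OF H[unfolded f]]])
        (rule ext, simp add: A_def B_def t_def divide_simps alg_denominator_nz,
          simp add: power2_eq_square algebra_simps)+
  qed
  then show ?case using mem unfolding t_def by blast
next
  case (scale f c)
  then obtain p q where *: "p \<in> alg m" "q \<in> alg m" "has_partials f p q" by blast
  show ?case
    using has_partials_linear[OF bounded_linear_mult_right *(3), of c] *(1,2)
    by (blast intro: alg.scale)
next
  case (add f g)
  then obtain p q p' q' where *: "p \<in> alg m" "q \<in> alg m" "has_partials f p q"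
    "p' \<in> alg m" "q' \<in> alg m" "has_partials g p' q'" by blast
  show ?case
    using has_partials_add[OF *(3) *(6)] *(1,2,4,5) by (blast intro: alg.add)
next
  case (mult f g)
  then obtain p q p' q' where *: "p \<in> alg m" "q \<in> alg m" "has_partials f p q"
    "p' \<in> alg m" "q' \<in> alg m" "has_partials g p' q'" by blast
  have "(\<lambda>z. p z * g z + f z * p' z) \<in> alg m" "(\<lambda>z. q z * g z + f z * q' z) \<in> alg m"
    using * mult.hyps by (auto intro: alg.add alg.mult)
  then show ?case
    using has_partials_mult[OF *(3) *(6)] by blast
qed

text \<open>Maps whose three components are real parts of members of the algebra.\<close>

definition alg_map :: "nat \<Rightarrow> map3 \<Rightarrow> bool"
  where "alg_map m v \<longleftrightarrow> (\<forall>i. \<exists>f\<in>alg m. \<forall>z. v z $ i = Re (f z))"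

lemma has_partials_componentwise:
  fixes v :: map3
  assumes "\<And>i. has_partials (\<lambda>z. v z $ i) (\<lambda>z. p z $ i) (\<lambda>z. q z $ i)"
  shows "has_partials v p q"
  unfolding has_partials_def
proof
  fix z
  show "(v has_derivative (\<lambda>h. Re h *\<^sub>R p z + Im h *\<^sub>R q z)) (at z)"
    using has_partialsD[OF assms]
    by (subst has_derivative_componentwise_within) (auto simp: Basis_vec_def inner_axis)
qed

lemma alg_map_partials:
  assumes "alg_map m v"
  shows "has_partials v (dx v) (dy v)" "alg_map m (dx v)" "alg_map m (dy v)"
proof -
  obtain f where f: "f i \<in> alg m" "v z $ i = Re (f i z)" for i z
    using assms unfolding alg_map_def by metis
  obtain p q where pq: "p i \<in> alg m" "q i \<in> alg m" "has_partials (f i) (p i) (q i)" for i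
    using alg_partials[OF f(1)] by metis
  have h: "has_partials v (\<lambda>z. \<chi> i. Re (p i z)) (\<lambda>z. \<chi> i. Re (q i z))"
    by (rule has_partials_componentwise)
      (simp add: f(2) has_partials_linear[OF bounded_linear_Re pq(3)])
  note d = has_partials_imp_dx_dy[OF h]
  show "has_partials v (dx v) (dy v)" "alg_map m (dx v)" "alg_map m (dy v)"
    using h pq(1,2) unfolding d alg_map_def by auto
qed

lemma alg_map_C1:
  assumes "alg_map m v"
  shows "C1 v"
  using alg_map_partials[OF assms] alg_map_partials(1)[of m "dx v"] alg_map_partials(1)[of m "dy v"]
    has_partials_imp_dx_dy(1) differentiable_imp_continuous_on
  unfolding C1_def by blast

lemma alg_map_C2: "alg_map m v \<Longrightarrow> C2 v"
  unfolding C2_def by (blast intro: alg_map_C1 alg_map_partials(2,3))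

lemma alg_map_bounded:
  assumes "alg_map m v"
  shows "\<exists>B. \<forall>z. norm (v z) \<le> B"
proof -
  obtain f where f: "f i \<in> alg m" "v z $ i = Re (f i z)" for i z
    using assms unfolding alg_map_def by metis
  obtain B where B: "cmod (f i z) \<le> B i" for i z
    using alg_bounded[OF f(1)] by metis
  have "norm (v z) \<le> (\<Sum>i\<in>UNIV. B i)" for z
  proof -
    have "norm (v z) \<le> (\<Sum>i\<in>UNIV. \<bar>v z $ i\<bar>)" by (rule norm_le_l1_cart)
    also have "\<dots> \<le> (\<Sum>i\<in>UNIV. B i)"
      by (intro sum_mono) (metis B f(2) abs_Re_le_cmod order_trans)
    finally show ?thesis .
  qed
  then show ?thesis by blast
qed

lemma alg_map_C2_bounded:
  assumes v: "alg_map m v"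
  shows "bdd_above (range (\<lambda>z. norm (v z) + norm (grad v z) + norm (hess v z)))"
proof -
  have *: "\<exists>B. \<forall>z. norm (grad u z) \<le> B" if u: "alg_map m u" for u
  proof -
    obtain A B where "norm (dx u z) \<le> A" "norm (dy u z) \<le> B" for z
      using alg_map_bounded[OF alg_map_partials(2)[OF u]]
        alg_map_bounded[OF alg_map_partials(3)[OF u]] by metis
    then have "norm (grad u z) \<le> A + B" for z
      unfolding grad_def by (meson add_mono norm_Pair_le order_trans)
    then show ?thesis by blast
  qed
  obtain a b c d where "norm (v z) \<le> a" "norm (grad v z) \<le> b"
      "norm (grad (dx v) z) \<le> c" "norm (grad (dy v) z) \<le> d" for z
    using alg_map_bounded[OF v] *[OF v] *[OF alg_map_partials(2)[OF v]] *[OF alg_map_partials(3)[OF v]]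
    by metis
  then have "norm (v z) + norm (grad v z) + norm (hess v z) \<le> a + b + (c + d)" for z
    unfolding hess_def by (meson add_mono norm_Pair_le order_trans)
  then show ?thesis by (intro bdd_aboveI2)
qed

section \<open>Stereographic projection\<close>

text \<open>The factor \<open>1 + \<bar>w\<bar>\<^sup>2\<close>; the round metric of the sphere is \<open>(2 / conf w)\<^sup>2 \<bar>dw\<bar>\<^sup>2\<close> in the stereographic coordinate.\<close>

definition conf :: "complex \<Rightarrow> real"
  where "conf w = 1 + (cmod w)\<^sup>2"

text \<open>Inverse stereographic projection, sending \<open>\<infinity>\<close> to the north pole \<open>(0, 0, 1)\<close>.\<close>

definition stereo :: "complex \<Rightarrow> real^3"
  where "stereo w = (1 / conf w) *\<^sub>R vector [2 * Re w, 2 * Im w, (cmod w)\<^sup>2 - 1]"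

text \<open>The pairing of \<open>x\<close> with the vector \<open>n(w) = (1 - w\<^sup>2, \<i> (1 + w\<^sup>2), 2w)\<close> in complex 3-space. The vector is
  null (\<open>n \<cdot> n = 0\<close>), orthogonal to \<open>stereo w\<close>, and holomorphic in \<open>w\<close>; \<open>n(w)\<close>, its conjugate and \<open>stereo w\<close> span
  complex 3-space. So \<open>n \<cdot> x\<close> is a complex coordinate for the tangent vector \<open>x\<close>.\<close>

definition null_form :: "complex \<Rightarrow> real^3 \<Rightarrow> complex"
  where "null_form w x = (1 - w\<^sup>2) * x$1 + \<i> * (1 + w\<^sup>2) * x$2 + 2 * w * x$3"

text \<open>The derivative of \<^const>\<open>null_form\<close> with respect to \<open>w\<close>.\<close>

definition null_form' :: "complex \<Rightarrow> real^3 \<Rightarrow> complex"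
  where "null_form' w x = - 2 * w * x$1 + 2 * \<i> * w * x$2 + 2 * x$3"

text \<open>The real part of \<open>c\<close> times the conjugate of \<open>n(w)\<close>, over \<open>(conf w)\<^sup>2\<close>: the tangent vector at \<open>stereo w\<close> with complex
  coordinate \<open>c\<close>.\<close>

definition tangent_lift :: "complex \<Rightarrow> complex \<Rightarrow> real^3"
  where "tangent_lift w c = (1 / (conf w)\<^sup>2) *\<^sub>R
    vector [Re (c * cnj (1 - w\<^sup>2)), Re (c * cnj (\<i> * (1 + w\<^sup>2))), Re (c * cnj (2 * w))]"

lemma conf_pos: "conf w > 0"
  by (simp add: conf_def add_pos_nonneg)

lemma conf_nz [simp]: "conf w \<noteq> 0"
  using conf_pos[of w] by simp

lemma conf_eq: "conf w = 1 + (Re w)\<^sup>2 + (Im w)\<^sup>2"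
  by (simp add: conf_def cmod_power2)

lemma conf_complex: "complex_of_real (conf w) = 1 + w * cnj w"
  by (simp add: conf_def complex_norm_square[symmetric])

lemma inner_real3: "(x::real^3) \<bullet> y = x$1 * y$1 + x$2 * y$2 + x$3 * y$3"
  by (simp add: inner_vec_def sum_3)

lemma inner_tangent_lift: "tangent_lift w c \<bullet> x = Re (c * cnj (null_form w x)) / (conf w)\<^sup>2"
proof -
  have "vector [Re (c * cnj (1 - w\<^sup>2)), Re (c * cnj (\<i> * (1 + w\<^sup>2))), Re (c * cnj (2 * w))] \<bullet> x =
      Re (c * cnj (null_form w x))"
    by (simp add: null_form_def inner_real3 algebra_simps)
  then show ?thesis by (simp add: tangent_lift_def)
qed

lemma null_form_scaleR: "null_form w (r *\<^sub>R x) = r * null_form w x"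
  by (simp add: null_form_def algebra_simps)

lemma null_form_add: "null_form w (x + y) = null_form w x + null_form w y"
  by (simp add: null_form_def algebra_simps)

lemma stereo_nth:
  "stereo w $ 1 = 2 * Re w / conf w" "stereo w $ 2 = 2 * Im w / conf w"
  "stereo w $ 3 = ((Re w)\<^sup>2 + (Im w)\<^sup>2 - 1) / conf w"
  by (simp_all add: stereo_def cmod_power2)

lemma tangent_iff:
  "x \<bullet> stereo w = 0 \<longleftrightarrow> 2 * Re w * x$1 + 2 * Im w * x$2 + ((Re w)\<^sup>2 + (Im w)\<^sup>2 - 1) * x$3 = 0"
proof -
  have "x \<bullet> stereo w =
      (2 * Re w * x$1 + 2 * Im w * x$2 + ((Re w)\<^sup>2 + (Im w)\<^sup>2 - 1) * x$3) / conf w"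
    by (simp add: stereo_nth inner_real3 cmod_power2 add_divide_distrib ac_simps)
  then show ?thesis by simp
qed

lemma null_form_tangent_lift: "null_form w (tangent_lift w c) = c"
  unfolding tangent_lift_def null_form_scaleR
  by (simp add: divide_simps)
    (simp add: null_form_def conf_eq complex_eq_iff power2_eq_square algebra_simps)

lemma null_form_stereo: "null_form w (stereo w) = 0"
proof -
  have "null_form w (vector [2 * Re w, 2 * Im w, (cmod w)\<^sup>2 - 1]) = 0"
    unfolding cmod_power2
    by (simp add: null_form_def complex_eq_iff power2_eq_square algebra_simps)
  then show ?thesis
    by (simp add: stereo_def null_form_scaleR)
qed

lemma tangent_lift_tangent: "tangent_lift w c \<bullet> stereo w = 0"
  by (simp add: inner_tangent_lift null_form_stereo)

lemma inner_stereo_self: "stereo w \<bullet> stereo w = 1"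
proof -
  have "vector [2 * Re w, 2 * Im w, (cmod w)\<^sup>2 - 1] \<bullet> (vector [2 * Re w, 2 * Im w, (cmod w)\<^sup>2 - 1] :: real^3)
      = (conf w)\<^sup>2"
    unfolding inner_real3 conf_eq cmod_power2 by (simp add: power2_eq_square algebra_simps)
  then show ?thesis
    by (simp add: stereo_def power2_eq_square)
qed

lemma tangent_lift_null_form:
  assumes "x \<bullet> stereo w = 0"
  shows "tangent_lift w (null_form w x) = x"
proof -
  define a b where "a = Re w" and "b = Im w"
  define t where "t = 2 * a * x$1 + 2 * b * x$2 + (a\<^sup>2 + b\<^sup>2 - 1) * x$3"
  have t: "t = 0" using assms by (simp add: tangent_iff t_def a_def b_def)
  have w: "w = Complex a b" by (simp add: a_def b_def)
  have "Re (null_form w x * cnj (1 - w\<^sup>2)) = (conf w)\<^sup>2 * x$1 - 2 * a * t"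
    "Re (null_form w x * cnj (\<i> * (1 + w\<^sup>2))) = (conf w)\<^sup>2 * x$2 - 2 * b * t"
    "Re (null_form w x * cnj (2 * w)) = (conf w)\<^sup>2 * x$3 - (a\<^sup>2 + b\<^sup>2 - 1) * t"
    unfolding conf_eq t_def w by (simp_all add: null_form_def power2_eq_square) algebra+
  then show ?thesis
    by (simp add: tangent_lift_def t vec_eq_iff forall_3)
qed

lemma norm_tangent_lift: "(norm (tangent_lift w c))\<^sup>2 = (cmod c)\<^sup>2 / (conf w)\<^sup>2"
  unfolding power2_norm_eq_inner[of "tangent_lift w c"] inner_tangent_lift null_form_tangent_lift
  unfolding cmod_power2 by (simp add: power2_eq_square)

text \<open>In terms of vectors, \<open>n' = (2 w\<^sup>* / conf w) n - 2 stereo w\<close> with \<open>w\<^sup>*\<close> the conjugate of \<open>w\<close>.\<close>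

lemma null_form'_eq:
  "null_form' w x = 2 * cnj w / conf w * null_form w x - 2 * (stereo w \<bullet> x)"
proof -
  have "conf w * null_form' w x = 2 * cnj w * null_form w x - 2 * conf w * (stereo w \<bullet> x)"
    unfolding inner_real3 stereo_nth null_form_def null_form'_def
    by (simp add: complex_eq_iff distrib_left cmod_power2)
      (simp add: conf_eq power2_eq_square algebra_simps)
  then show ?thesis by (simp add: field_simps)
qed

lemma norm_null_form_le: "cmod (null_form w x) \<le> 4 * conf w * norm x"
proof -
  have n: "cmod (1 - w\<^sup>2) \<le> conf w" "cmod (1 + w\<^sup>2) \<le> conf w"
    using norm_triangle_ineq4[of 1 "w\<^sup>2"] norm_triangle_ineq[of 1 "w\<^sup>2"]
    by (simp_all add: conf_def norm_power)
  have "2 * cmod w \<le> conf w"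
    using zero_le_power2[of "cmod w - 1"]
    unfolding conf_def power2_eq_square by (simp add: algebra_simps)
  then have m: "2 * cmod w \<le> 2 * conf w"
    using conf_pos[of w] by linarith
  have x: "\<bar>x$i\<bar> \<le> norm x" for i
    by (rule component_le_norm_cart)
  have "cmod (null_form w x) \<le> cmod (1 - w\<^sup>2) * \<bar>x$1\<bar> + cmod (1 + w\<^sup>2) * \<bar>x$2\<bar> + 2 * cmod w * \<bar>x$3\<bar>"
    unfolding null_form_def
    by (rule order_trans[OF norm_triangle_ineq] add_mono)+ (simp_all add: norm_mult)
  also have "\<dots> \<le> conf w * norm x + conf w * norm x + 2 * conf w * norm x"
    using n m x conf_pos[of w] by (intro add_mono mult_mono) auto
  finally show ?thesis by (simp add: algebra_simps)
qed

lemma bounded_linear_tangent_lift: "bounded_linear (tangent_lift w)"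
  by (intro linear_conv_bounded_linear[THEN iffD1] linearI)
    (simp_all add: tangent_lift_def vec_eq_iff forall_3 algebra_simps add_divide_distrib diff_divide_distrib)

text \<open>The differential of \<^const>\<open>stereo\<close> at \<open>w\<close> is \<open>h \<mapsto> tangent_lift w (2 h)\<close>.\<close>

lemma has_partials_stereo:
  assumes w: "\<And>z. (w has_field_derivative w' z) (at z)"
  shows "has_partials (\<lambda>z. stereo (w z)) (\<lambda>z. tangent_lift (w z) (2 * w' z)) (\<lambda>z. tangent_lift (w z) (2 * \<i> * w' z))"
  unfolding has_partials_def
proof
  fix z
  define h where "h = (\<lambda>t. w' z * t)"
  have W: "(w has_derivative h) (at z)"
    using w[of z] by (simp add: has_field_derivative_def h_def)
  have R: "((\<lambda>z. Re (w z)) has_derivative (\<lambda>t. Re (h t))) (at z)"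
    "((\<lambda>z. Im (w z)) has_derivative (\<lambda>t. Im (h t))) (at z)"
    using W by (auto intro: derivative_intros)
  have C: "((\<lambda>z. conf (w z)) has_derivative (\<lambda>t. 2 * Re (w z) * Re (h t) + 2 * Im (w z) * Im (h t))) (at z)"
    unfolding conf_eq by (auto intro!: derivative_eq_intros W)
  have C2: "((\<lambda>z. (Re (w z))\<^sup>2 + (Im (w z))\<^sup>2 - 1) has_derivative (\<lambda>t. 2 * Re (w z) * Re (h t) + 2 * Im (w z) * Im (h t))) (at z)"
    by (auto intro!: derivative_eq_intros W)
  have "((\<lambda>z. stereo (w z) $ i) has_derivative (\<lambda>t. tangent_lift (w z) (2 * h t) $ i)) (at z)" for i
  proof -
    consider "i = 1" | "i = 2" | "i = 3" using exhaust_3 by blast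
    then show ?thesis
    proof cases
      case 1
      show ?thesis unfolding 1 stereo_nth
        by (rule has_derivative_eq_rhs[OF has_derivative_divide[OF has_derivative_mult_right[OF R(1)] C conf_nz]])
          (simp add: fun_eq_iff tangent_lift_def divide_simps, simp add: conf_eq power2_eq_square algebra_simps)
    next
      case 2
      show ?thesis unfolding 2 stereo_nth
        by (rule has_derivative_eq_rhs[OF has_derivative_divide[OF has_derivative_mult_right[OF R(2)] C conf_nz]])
          (simp add: fun_eq_iff tangent_lift_def divide_simps, simp add: conf_eq power2_eq_square algebra_simps)
    next
      case 3
      show ?thesis unfolding 3 stereo_nth
        by (rule has_derivative_eq_rhs[OF has_derivative_divide[OF C2 C conf_nz]])
          (simp add: fun_eq_iff tangent_lift_def divide_simps, simp add: conf_eq cmod_power2 power2_eq_square algebra_simps)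
    qed
  qed
  then have "((\<lambda>z. stereo (w z)) has_derivative (\<lambda>t. tangent_lift (w z) (2 * h t))) (at z)"
    by (subst has_derivative_componentwise_within) (auto simp: Basis_vec_def inner_axis)
  moreover have "tangent_lift (w z) (2 * h t) =
      Re t *\<^sub>R tangent_lift (w z) (2 * w' z) + Im t *\<^sub>R tangent_lift (w z) (2 * \<i> * w' z)" for t
  proof -
    have "2 * h t = Re t *\<^sub>R (2 * w' z) + Im t *\<^sub>R (2 * \<i> * w' z)"
      by (simp add: complex_eq_iff h_def algebra_simps)
    then show ?thesis
      by (simp only: linear_add[OF bounded_linear.linear[OF bounded_linear_tangent_lift]]
        linear_scale[OF bounded_linear.linear[OF bounded_linear_tangent_lift]])
  qed
  ultimately show "((\<lambda>z. stereo (w z)) has_derivative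
      (\<lambda>t. Re t *\<^sub>R tangent_lift (w z) (2 * w' z) + Im t *\<^sub>R tangent_lift (w z) (2 * \<i> * w' z))) (at z)"
    by simp
qed

lemma has_partials_component: "has_partials v p q \<Longrightarrow>
   has_partials (\<lambda>z. complex_of_real (v z $ i)) (\<lambda>z. p z $ i) (\<lambda>z. q z $ i)"
  by (intro has_partials_linear[OF bounded_linear_of_real] has_partials_linear[OF bounded_linear_vec_nth])

lemma has_partials_null_form:
  assumes w: "\<And>z. (w has_field_derivative w' z) (at z)" and v: "has_partials v p q"
  shows "has_partials (\<lambda>z. null_form (w z) (v z))
    (\<lambda>z. w' z * null_form' (w z) (v z) + null_form (w z) (p z))
    (\<lambda>z. \<i> * w' z * null_form' (w z) (v z) + null_form (w z) (q z))"
proof -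
  have h: "has_partials (\<lambda>z. 1 - (w z)\<^sup>2) (\<lambda>z. - 2 * w z * w' z) (\<lambda>z. \<i> * (- 2 * w z * w' z))"
    "has_partials (\<lambda>z. \<i> * (1 + (w z)\<^sup>2)) (\<lambda>z. 2 * \<i> * w z * w' z) (\<lambda>z. \<i> * (2 * \<i> * w z * w' z))"
    "has_partials (\<lambda>z. 2 * w z) (\<lambda>z. 2 * w' z) (\<lambda>z. \<i> * (2 * w' z))"
    by (rule has_partials_holomorphic, auto intro!: derivative_eq_intros w)+
  have "has_partials (\<lambda>z. null_form (w z) (v z))
    (\<lambda>z. - 2 * w z * w' z * (v z $ 1) + (1 - (w z)\<^sup>2) * (p z $ 1)
      + (2 * \<i> * w z * w' z * (v z $ 2) + \<i> * (1 + (w z)\<^sup>2) * (p z $ 2))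
      + (2 * w' z * (v z $ 3) + 2 * w z * (p z $ 3)))
    (\<lambda>z. \<i> * (- 2 * w z * w' z) * (v z $ 1) + (1 - (w z)\<^sup>2) * (q z $ 1)
      + (\<i> * (2 * \<i> * w z * w' z) * (v z $ 2) + \<i> * (1 + (w z)\<^sup>2) * (q z $ 2))
      + (\<i> * (2 * w' z) * (v z $ 3) + 2 * w z * (q z $ 3)))"
    unfolding null_form_def
    by (intro has_partials_add has_partials_mult h has_partials_component v)
  then show ?thesis
    by (rule back_subst[of "\<lambda>p. has_partials _ p _", OF back_subst[of "has_partials _ _"]])
      (simp_all add: fun_eq_iff null_form_def null_form'_def algebra_simps)
qed

section \<open>The linearised operator at a holomorphic map\<close>

text \<open>An entire function together with its first two derivatives; \<open>stereo \<circ> w\<close> is then a harmonic map into the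
  sphere.\<close>

locale entire_map =
  fixes w w' w'' :: "complex \<Rightarrow> complex"
  assumes w: "\<And>z. (w has_field_derivative w' z) (at z)"
    and w': "\<And>z. (w' has_field_derivative w'' z) (at z)"
begin

abbreviation u :: map3
  where "u \<equiv> \<lambda>z. stereo (w z)"

text \<open>\<open>n(w) \<cdot> (v\<^sub>x + \<i> v\<^sub>y)\<close>. As \<open>n(w(z))\<close> is holomorphic in \<open>z\<close>, this is \<open>(\<partial>\<^sub>x + \<i> \<partial>\<^sub>y) (n(w) \<cdot> v)\<close>, which
  vanishes exactly when the complex coordinate of \<open>v\<close> is holomorphic.\<close>

definition dbar :: "map3 \<Rightarrow> complex \<Rightarrow> complex"
  where "dbar v z = null_form (w z) (dx v z) + \<i> * null_form (w z) (dy v z)"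

lemma dx_dy_u:
  "dx u = (\<lambda>z. tangent_lift (w z) (2 * w' z))" "dy u = (\<lambda>z. tangent_lift (w z) (2 * \<i> * w' z))"
  using has_partials_imp_dx_dy[OF has_partials_stereo[OF w]] by auto

lemma norm_grad_u: "(norm (grad u z))\<^sup>2 = 8 * (cmod (w' z))\<^sup>2 / (conf (w z))\<^sup>2"
  by (simp add: grad_def norm_Pair dx_dy_u norm_tangent_lift norm_mult power_mult_distrib)

lemma has_partials_null_form_dbar:
  assumes "C2 v"
  obtains p q where "has_partials (\<lambda>z. null_form (w z) (v z)) p q" "\<And>z. p z + \<i> * q z = dbar v z"
proof (rule that[OF has_partials_null_form[OF w has_partials_dx_dy]])
  show "v differentiable_on UNIV" using assms by (simp add: C2_def C1_def)
qed (simp add: dbar_def algebra_simps)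

text \<open>Obtained by differentiating \<open>u \<cdot> v = 0\<close>.\<close>

lemma normal_derivative:
  assumes v: "C2 v" and tan: "\<And>z. v z \<bullet> u z = 0"
  shows "complex_of_real (u z \<bullet> dx v z) + \<i> * (u z \<bullet> dy v z) =
    cnj (w' z) * null_form (w z) (v z) * (- 2 / (conf (w z))\<^sup>2)"
proof -
  have "v differentiable_on UNIV" using v by (simp add: C2_def C1_def)
  from has_partials_inner[OF has_partials_dx_dy[OF this] has_partials_stereo[OF w]]
  have h: "has_partials (\<lambda>z. 0)
     (\<lambda>z. dx v z \<bullet> u z + v z \<bullet> tangent_lift (w z) (2 * w' z))
     (\<lambda>z. dy v z \<bullet> u z + v z \<bullet> tangent_lift (w z) (2 * \<i> * w' z))"
    by (simp add: tan)
  have "dx v z \<bullet> u z + v z \<bullet> tangent_lift (w z) (2 * w' z) = 0"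
    "dy v z \<bullet> u z + v z \<bullet> tangent_lift (w z) (2 * \<i> * w' z) = 0"
    using fun_cong[OF has_partials_unique(1)[OF h has_partials_const]]
      fun_cong[OF has_partials_unique(2)[OF h has_partials_const]] by simp_all
  then have "u z \<bullet> dx v z = - (tangent_lift (w z) (2 * w' z) \<bullet> v z)"
    "u z \<bullet> dy v z = - (tangent_lift (w z) (2 * \<i> * w' z) \<bullet> v z)"
    by (simp_all add: inner_commute)
  then show ?thesis
    unfolding inner_tangent_lift by (simp add: complex_eq_iff divide_simps algebra_simps)
qed

lemma has_partials_conf_power:
  "has_partials (\<lambda>z. k / (complex_of_real (conf (w z)))\<^sup>2)
    (\<lambda>z. - 2 * k / (complex_of_real (conf (w z)))^3 * (w' z * cnj (w z) + w z * cnj (w' z)))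
    (\<lambda>z. - 2 * k / (complex_of_real (conf (w z)))^3 * (\<i> * w' z * cnj (w z) + w z * cnj (\<i> * w' z)))"
proof -
  have c: "has_partials (\<lambda>z. complex_of_real (conf (w z)))
      (\<lambda>z. w' z * cnj (w z) + w z * cnj (w' z)) (\<lambda>z. \<i> * w' z * cnj (w z) + w z * cnj (\<i> * w' z))"
    unfolding conf_complex
    using has_partials_add[OF has_partials_const[of 1] has_partials_mult[OF has_partials_holomorphic[OF w]
      has_partials_linear[OF bounded_linear_cnj has_partials_holomorphic[OF w]]]] by simp
  show ?thesis
    by (rule has_partials_chain[OF c])
      (auto intro!: derivative_eq_intros simp: divide_simps power2_eq_square power3_eq_cube)
qed

text \<open>The tangential part of the linearised equation is a first order equation for \<^term>\<open>dbar v\<close>: the part of the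
  derivative of \<open>n\<close> along \<open>u\<close> contributes exactly the term \<open>\<bar>\<nabla>u\<bar>\<^sup>2 (n \<cdot> v)\<close> of \<open>n \<cdot> L[v]\<close>.\<close>

lemma dbar_equation:
  assumes v: "C2 v" and tan: "\<And>z. v z \<bullet> u z = 0"
  obtains p q where "has_partials (dbar v) p q"
    "\<And>z. p z - \<i> * q z =
      4 * w' z * cnj (w z) / conf (w z) * dbar v z + null_form (w z) (L_op u v z)"
proof -
  have h: "has_partials (dx v) (dx (dx v)) (dy (dx v))" "has_partials (dy v) (dx (dy v)) (dy (dy v))"
    using v by (auto simp: C2_def C1_def intro: has_partials_dx_dy)
  note n = has_partials_null_form[OF w]
  have i: "has_partials (\<lambda>z. \<i>) (\<lambda>z. 0) (\<lambda>z. 0)" by (rule has_partials_const)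
  note H = has_partials_add[OF n[OF h(1)] has_partials_mult[OF i n[OF h(2)]], folded dbar_def]
  show thesis
  proof (rule that[OF H])
    fix z
    define R where "R = complex_of_real (conf (w z))"
    have R: "R \<noteq> 0" by (simp add: R_def)
    have nL: "null_form (w z) (L_op u v z) =
        null_form (w z) (dx (dx v) z) + null_form (w z) (dy (dy v) z)
        + 8 * (w' z * cnj (w' z)) / R\<^sup>2 * null_form (w z) (v z)"
      unfolding L_op_def laplacian_def null_form_add null_form_scaleR null_form_stereo norm_grad_u
      by (simp add: R_def complex_norm_square[symmetric])
    have "null_form' (w z) (dx v z) + \<i> * null_form' (w z) (dy v z)
        = 2 * cnj (w z) / R * dbar v z - 2 * (complex_of_real (u z \<bullet> dx v z) + \<i> * (u z \<bullet> dy v z))"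
      unfolding null_form'_eq dbar_def R_def by (simp add: algebra_simps)
    also have "\<dots> = 2 * cnj (w z) / R * dbar v z + 4 * cnj (w' z) / R\<^sup>2 * null_form (w z) (v z)"
      unfolding normal_derivative[OF v tan] by (simp add: R_def)
    finally have n': "2 * w' z * (null_form' (w z) (dx v z) + \<i> * null_form' (w z) (dy v z)) =
       4 * w' z * cnj (w z) / R * dbar v z
       + 8 * (w' z * cnj (w' z)) / R\<^sup>2 * null_form (w z) (v z)"
      by (simp add: algebra_simps)
    show "w' z * null_form' (w z) (dx v z) + null_form (w z) (dx (dx v) z) +
        (0 * null_form (w z) (dy v z) + \<i> * (w' z * null_form' (w z) (dy v z) + null_form (w z) (dx (dy v) z)))
      - \<i> * (\<i> * w' z * null_form' (w z) (dx v z) + null_form (w z) (dy (dx v) z) +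
        (0 * null_form (w z) (dy v z) + \<i> * (\<i> * w' z * null_form' (w z) (dy v z) + null_form (w z) (dy (dy v) z))))
      = 4 * w' z * cnj (w z) / conf (w z) * dbar v z + null_form (w z) (L_op u v z)"
      \<comment> \<open>The left side contains \<open>\<i> n \<cdot> (\<partial>\<^sub>x \<partial>\<^sub>y v - \<partial>\<^sub>y \<partial>\<^sub>x v)\<close>, which vanishes.\<close>
      using n' unfolding nL dx_dy_commute[OF v] R_def by (simp add: algebra_simps)
  qed
qed

text \<open>The normal part of the linearised equation holds for every tangential field. This follows on applying
  \<open>\<partial>\<^sub>x - \<i> \<partial>\<^sub>y\<close> to the identity of \<open>normal_derivative\<close> and taking real parts.\<close>

lemma L_op_tangent:
  assumes v: "C2 v" and tan: "\<And>z. v z \<bullet> u z = 0"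
  shows "L_op u v z \<bullet> u z = 0"
proof -
  have h: "has_partials v (dx v) (dy v)" "has_partials (dx v) (dx (dx v)) (dy (dx v))"
    "has_partials (dy v) (dx (dy v)) (dy (dy v))"
    using v by (auto simp: C2_def C1_def intro: has_partials_dx_dy)
  note of = has_partials_linear[OF bounded_linear_of_real]
  note U = has_partials_stereo[OF w]
  have i: "has_partials (\<lambda>z. \<i>) (\<lambda>z. 0) (\<lambda>z. 0)" by (rule has_partials_const)
  let ?N = "\<lambda>z. null_form (w z) (v z)"
  note R = has_partials_conf_power[of "- 2"]
  note A = has_partials_mult[OF has_partials_mult[OF
      has_partials_linear[OF bounded_linear_cnj has_partials_holomorphic[OF w']]
      has_partials_null_form[OF w h(1)]] R]
  note B = has_partials_add[OF of[OF has_partials_inner[OF U h(2)]]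
      has_partials_mult[OF i of[OF has_partials_inner[OF U h(3)]]]]
  have "(\<lambda>z. complex_of_real (u z \<bullet> dx v z) + \<i> * (u z \<bullet> dy v z)) =
      (\<lambda>z. cnj (w' z) * ?N z * (- 2 / (complex_of_real (conf (w z)))\<^sup>2))"
    by (rule ext) (use normal_derivative[OF v tan] in simp)
  note B' = B[unfolded this]
  note eq = fun_cong[OF has_partials_unique(1)[OF B' A], of z]
    fun_cong[OF has_partials_unique(2)[OF B' A], of z]
  define S where "S = complex_of_real (conf (w z))"
  have S: "S \<noteq> 0" by (simp add: S_def)
  define a b where "a = null_form (w z) (dx v z)" and "b = null_form (w z) (dy v z)"
  let ?ux = "tangent_lift (w z) (2 * w' z)" and ?uy = "tangent_lift (w z) (2 * \<i> * w' z)"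
  have nt: "null_form' (w z) (v z) = 2 * cnj (w z) / S * ?N z"
    using tan[of z] by (simp add: null_form'_eq inner_commute S_def)
  have "complex_of_real (?ux \<bullet> dx v z + u z \<bullet> dx (dx v) z + ?uy \<bullet> dy v z + u z \<bullet> dy (dy v) z)
      + \<i> * (?ux \<bullet> dy v z + u z \<bullet> dx (dy v) z - ?uy \<bullet> dx v z - u z \<bullet> dy (dx v) z)
    = cnj (w' z) * (a - \<i> * b) * (- 2 / S\<^sup>2)"
    (is "?l = ?r")
  proof -
    have "?l = (complex_of_real (?ux \<bullet> dx v z + u z \<bullet> dx (dx v) z) +
        (0 * complex_of_real (u z \<bullet> dy v z) + \<i> * complex_of_real (?ux \<bullet> dy v z + u z \<bullet> dx (dy v) z)))
      - \<i> * (complex_of_real (?uy \<bullet> dx v z + u z \<bullet> dy (dx v) z) +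
        (0 * complex_of_real (u z \<bullet> dy v z) + \<i> * complex_of_real (?uy \<bullet> dy v z + u z \<bullet> dy (dy v) z)))"
      by (simp add: complex_eq_iff)
    also have "\<dots> = ?r"
      unfolding eq nt a_def[symmetric] b_def[symmetric] S_def[symmetric] using S
      by (simp add: divide_simps) (simp add: power2_eq_square power3_eq_cube algebra_simps)
    finally show ?thesis .
  qed
  moreover have "Re ?l = ?ux \<bullet> dx v z + u z \<bullet> dx (dx v) z + ?uy \<bullet> dy v z + u z \<bullet> dy (dy v) z"
    by simp
  ultimately have "?ux \<bullet> dx v z + u z \<bullet> dx (dx v) z + ?uy \<bullet> dy v z + u z \<bullet> dy (dy v) z
      = Re (cnj (w' z) * (a - \<i> * b) * (- 2 / S\<^sup>2))"
    by metis
  also have "\<dots> = - (?ux \<bullet> dx v z + ?uy \<bullet> dy v z)"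
    unfolding inner_tangent_lift a_def[symmetric] b_def[symmetric] S_def of_real_power[symmetric]
    by (simp add: divide_simps algebra_simps)
  finally have "u z \<bullet> laplacian v z + 2 * (grad u z \<bullet> grad v z) = 0"
    by (simp add: laplacian_def grad_def dx_dy_u inner_add_right)
  then show ?thesis
    using tan[of z] inner_stereo_self[of "w z"] by (simp add: L_op_def inner_add_left inner_add_right inner_commute)
qed

lemma L_op_eq_0_iff:
  assumes "C2 v" "\<And>z. v z \<bullet> u z = 0"
  shows "L_op u v z = 0 \<longleftrightarrow> null_form (w z) (L_op u v z) = 0"
proof
  assume "null_form (w z) (L_op u v z) = 0"
  with tangent_lift_null_form[OF L_op_tangent[OF assms, of z]] show "L_op u v z = 0"
    by (simp add: linear_0[OF bounded_linear.linear[OF bounded_linear_tangent_lift]])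
qed (simp add: null_form_def)

lemma kernel_of_holomorphic:
  assumes v: "C2 v" and tan: "\<And>z. v z \<bullet> u z = 0"
    and hol: "\<And>z. ((\<lambda>z. null_form (w z) (v z)) has_field_derivative f' z) (at z)"
  shows "L_op u v z = 0"
proof -
  obtain p q where pq: "has_partials (\<lambda>z. null_form (w z) (v z)) p q" "\<And>z. p z + \<i> * q z = dbar v z"
    using has_partials_null_form_dbar[OF v] by blast
  have "dbar v = (\<lambda>z. 0)"
    using has_partials_unique[OF pq(1) has_partials_holomorphic[OF hol]] pq(2) by auto
  moreover obtain p q where "has_partials (dbar v) p q"
    "\<And>z. p z - \<i> * q z =
      4 * w' z * cnj (w z) / conf (w z) * dbar v z + null_form (w z) (L_op u v z)"
    using dbar_equation[OF v tan] by blast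
  ultimately have "null_form (w z) (L_op u v z) = 0"
    using has_partials_unique[OF _ has_partials_const] by (metis add_0 diff_0_right mult_zero_right)
  then show ?thesis
    using L_op_eq_0_iff[OF v tan] by simp
qed

text \<open>When \<open>L[v] = 0\<close>, the equation for \<^term>\<open>dbar v\<close> says that \<open>1 / (conf w)\<^sup>2\<close> is an integrating factor: after conjugation it becomes the
  Cauchy--Riemann equation.\<close>

lemma dbar_holomorphic:
  assumes v: "C2 v" and tan: "\<And>z. v z \<bullet> u z = 0" and L: "\<And>z. L_op u v z = 0"
  shows "(\<lambda>z. cnj (dbar v z) * (1 / (complex_of_real (conf (w z)))\<^sup>2)) holomorphic_on UNIV"
proof -
  obtain p q where pq: "has_partials (dbar v) p q"
    "\<And>z. p z - \<i> * q z = 4 * w' z * cnj (w z) / conf (w z) * dbar v z"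
    using dbar_equation[OF v tan] L by (auto simp: null_form_def)
  note R = has_partials_conf_power[of 1]
  note H = has_partials_mult[OF has_partials_linear[OF bounded_linear_cnj pq(1)] R]
  show ?thesis
  proof (rule has_partials_imp_holomorphic[OF H])
    fix z
    define S where "S = complex_of_real (conf (w z))"
    have S: "S \<noteq> 0" "cnj S = S" by (simp_all add: S_def)
    have e: "cnj (p z) + \<i> * cnj (q z) = 4 * cnj (w' z) * w z / S * cnj (dbar v z)"
      using arg_cong[OF pq(2)[of z], of cnj] by (simp add: S_def)
    have "cnj (p z) * (1 / S\<^sup>2) + cnj (dbar v z) * (- 2 * 1 / S ^ 3 * (w' z * cnj (w z) + w z * cnj (w' z))) +
      \<i> * (cnj (q z) * (1 / S\<^sup>2) + cnj (dbar v z) * (- 2 * 1 / S ^ 3 * (\<i> * w' z * cnj (w z) + w z * cnj (\<i> * w' z))))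
      = (cnj (p z) + \<i> * cnj (q z)) / S\<^sup>2 - 4 * cnj (dbar v z) * w z * cnj (w' z) / S ^ 3"
      using S by (simp add: divide_simps) (simp add: power2_eq_square power3_eq_cube algebra_simps)
    also have "\<dots> = 0"
      unfolding e using S by (simp add: divide_simps) (simp add: power2_eq_square power3_eq_cube algebra_simps)
    finally show "cnj (p z) * (1 / (complex_of_real (conf (w z)))\<^sup>2) +
        cnj (dbar v z) * (- 2 * 1 / complex_of_real (conf (w z)) ^ 3 * (w' z * cnj (w z) + w z * cnj (w' z))) +
      \<i> * (cnj (q z) * (1 / (complex_of_real (conf (w z)))\<^sup>2) +
        cnj (dbar v z) * (- 2 * 1 / complex_of_real (conf (w z)) ^ 3 *
          (\<i> * w' z * cnj (w z) + w z * cnj (\<i> * w' z)))) = 0"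
      unfolding S_def .
  qed
qed

text \<open>For \<open>v\<close> in the bounded kernel, \<^term>\<open>dbar v\<close> grows at most like \<open>conf w\<close>. So the entire function of \<open>dbar_holomorphic\<close> tends to \<open>0\<close> at
  infinity, and it vanishes by Liouville's theorem.\<close>

lemma bounded_kernel_holomorphic:
  assumes v: "v \<in> bounded_kernel u" and lim: "filterlim w at_infinity at_infinity"
  shows "(\<lambda>z. null_form (w z) (v z)) holomorphic_on UNIV"
    "\<exists>B. \<forall>z. cmod (null_form (w z) (v z)) \<le> B * conf (w z)"
proof -
  have k: "C2 v" "\<And>z. v z \<bullet> u z = 0" "\<And>z. L_op u v z = 0"
    using v by (auto simp: bounded_kernel_def)
  obtain B where B: "\<And>z. norm (v z) + norm (grad v z) + norm (hess v z) \<le> B"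
    using v by (auto simp: bounded_kernel_def bdd_above_def)
  have Bv: "norm (v z) \<le> B" and Bg: "norm (grad v z) \<le> B" for z
    using B[of z] norm_ge_zero[of "v z"] norm_ge_zero[of "grad v z"] norm_ge_zero[of "hess v z"]
    by linarith+
  have Bd: "norm (dx v z) \<le> B" "norm (dy v z) \<le> B" for z
    using Bg[of z] norm_fst_le[of "dx v z" "dy v z"] norm_snd_le[of "dy v z" "dx v z"]
    by (simp_all add: grad_def)
  let ?H = "\<lambda>z. cnj (dbar v z) * (1 / (complex_of_real (conf (w z)))\<^sup>2)"
  have d: "cmod (dbar v z) \<le> 8 * B * conf (w z)" for z
  proof -
    have "cmod (dbar v z) \<le> cmod (null_form (w z) (dx v z)) + cmod (null_form (w z) (dy v z))"
      unfolding dbar_def by (rule order_trans[OF norm_triangle_ineq]) (simp add: norm_mult)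
    also have "\<dots> \<le> 4 * conf (w z) * norm (dx v z) + 4 * conf (w z) * norm (dy v z)"
      by (intro add_mono norm_null_form_le)
    also have "\<dots> \<le> 4 * conf (w z) * B + 4 * conf (w z) * B"
      using conf_pos[of "w z"] Bd by (intro add_mono mult_left_mono) auto
    finally show ?thesis by simp
  qed
  have "(?H \<longlongrightarrow> 0) at_infinity"
  proof (rule Lim_null_comparison)
    show "\<forall>\<^sub>F z in at_infinity. norm (?H z) \<le> 8 * B * inverse (conf (w z))"
    proof (intro always_eventually allI)
      fix z
      have "norm (?H z) = cmod (dbar v z) / (conf (w z))\<^sup>2"
        by (simp add: norm_mult norm_divide norm_power)
      also have "\<dots> \<le> 8 * B * conf (w z) / (conf (w z))\<^sup>2"
        using d conf_pos[of "w z"] by (intro divide_right_mono) auto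
      finally show "norm (?H z) \<le> 8 * B * inverse (conf (w z))"
        by (simp add: power2_eq_square field_simps)
    qed
    have "filterlim (\<lambda>z. 1 + (cmod (w z))\<^sup>2) at_top at_infinity"
      by (intro filterlim_tendsto_add_at_top[OF tendsto_const] filterlim_pow_at_top
          filterlim_compose[OF filterlim_norm_at_top lim]) simp
    then have "((\<lambda>z. inverse (conf (w z))) \<longlongrightarrow> 0) at_infinity"
      unfolding conf_def by (rule tendsto_inverse_0_at_top)
    then show "((\<lambda>z. 8 * B * inverse (conf (w z))) \<longlongrightarrow> 0) at_infinity"
      by (rule tendsto_mult_right_zero)
  qed
  then have "?H z = 0" for z
    by (rule Liouville_weak[OF dbar_holomorphic[OF k]])
  then have d0: "dbar v z = 0" for z
    by simp
  obtain p q where pq: "has_partials (\<lambda>z. null_form (w z) (v z)) p q" "\<And>z. p z + \<i> * q z = dbar v z"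
    using has_partials_null_form_dbar[OF k(1)] by blast
  show "(\<lambda>z. null_form (w z) (v z)) holomorphic_on UNIV"
    by (rule has_partials_imp_holomorphic[OF pq(1)]) (simp add: pq(2) d0)
  have "cmod (null_form (w z) (v z)) \<le> (4 * B) * conf (w z)" for z
    using order_trans[OF norm_null_form_le[of "w z" "v z"]
        mult_left_mono[OF Bv[of z], of "4 * conf (w z)"]] conf_pos[of "w z"]
    by (simp add: ac_simps)
  then show "\<exists>B. \<forall>z. cmod (null_form (w z) (v z)) \<le> B * conf (w z)"
    by blast
qed

end

section \<open>The bounded kernel at a power map\<close>

lemma rcis_power_Re_Im: "Re (rcis r t ^ n) = r ^ n * cos (n * t)" "Im (rcis r t ^ n) = r ^ n * sin (n * t)"
  by (simp_all add: DeMoivre2)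

text \<open>The polar representation \<^term>\<open>rcis (cmod z) (Arg z) = z\<close> used here also holds at the origin.\<close>

lemma U_eq_stereo: "U m = (\<lambda>z. stereo (z ^ m))"
proof
  fix z
  have z: "rcis (cmod z) (Arg z) = z" by (rule rcis_cmod_Arg)
  have "(cmod (z ^ m))\<^sup>2 = cmod z ^ (2 * m)"
    by (simp add: norm_power power_mult mult.commute)
  then show "U m z = stereo (z ^ m)"
    using rcis_power_Re_Im[of "cmod z" "Arg z" m] unfolding z
    by (simp add: U_rational of_polar_def stereo_def conf_def mult.assoc)
qed

interpretation pow: entire_map "\<lambda>z. z ^ m" "\<lambda>z. of_nat m * z ^ (m - 1)"
  "\<lambda>z. of_nat m * (of_nat (m - 1) * z ^ (m - 1 - 1))" for m
  by unfold_locales (auto intro!: derivative_eq_intros)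

text \<open>The tangential field along \<open>stereo (z ^ m)\<close> with complex coordinate \<open>f\<close>.\<close>

definition tangent_field :: "nat \<Rightarrow> (complex \<Rightarrow> complex) \<Rightarrow> map3"
  where "tangent_field m f = (\<lambda>z. tangent_lift (z ^ m) (f z))"

lemma tangent_field_add: "tangent_field m (\<lambda>z. f z + g z) = tangent_field m f + tangent_field m g"
  by (simp add: tangent_field_def fun_eq_iff plus_fun_def bounded_linear.linear[OF bounded_linear_tangent_lift, THEN linear_add])

lemma tangent_field_scaleR: "tangent_field m (\<lambda>z. complex_of_real r * f z) = r *\<^sub>R tangent_field m f"
  using bounded_linear.linear[OF bounded_linear_tangent_lift, THEN linear_scale]
  by (simp add: tangent_field_def fun_eq_iff scaleR_fun_def scaleR_conv_of_real)

lemma alg_map_tangent_field: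
  assumes "k \<le> 2 * m"
  shows "alg_map m (tangent_field m (\<lambda>z. c * z ^ k))"
  unfolding alg_map_def
proof
  fix i :: 3
  define t where "t = (\<lambda>a b (z::complex). z ^ a * cnj z ^ b / (1 + z ^ m * cnj z ^ m))"
  have t: "t a b \<in> alg m" if "a + b \<le> 2 * m" for a b
    unfolding t_def using that by (rule alg.base)
  have D: "complex_of_real (conf (z ^ m)) = 1 + z ^ m * cnj z ^ m" for z
    by (simp add: conf_complex)
  have cnj_pow: "cnj z ^ (2 * m) = (cnj z ^ m)\<^sup>2" for z
    by (simp add: power_mult mult.commute)
  have tangent_lift: "tangent_lift (z ^ m) x $ i = Re (x * cnj (vector [1 - (z ^ m)\<^sup>2, \<i> * (1 + (z ^ m)\<^sup>2), 2 * z ^ m] $ i)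
      / (1 + z ^ m * cnj z ^ m)\<^sup>2)" for x z
  proof -
    have "Re (y / (1 + z ^ m * cnj z ^ m)\<^sup>2) = Re y / (conf (z ^ m))\<^sup>2" for y
      unfolding D[symmetric] of_real_power[symmetric] by simp
    then show ?thesis
      unfolding tangent_lift_def vector_scaleR_component using exhaust_3[of i]
      by (elim disjE) (simp_all only: vector_3, simp_all)
  qed
  have "\<exists>f\<in>alg m. \<forall>z. c * z ^ k * cnj (vector [1 - (z ^ m)\<^sup>2, \<i> * (1 + (z ^ m)\<^sup>2), 2 * z ^ m] $ i)
      / (1 + z ^ m * cnj z ^ m)\<^sup>2 = f z"
  proof -
    consider "i = 1" | "i = 2" | "i = 3" using exhaust_3 by blast
    then show ?thesis
    proof cases
      case 1
      have "(\<lambda>z. c * (t k 0 z * (t 0 0 z - t 0 (2 * m) z))) \<in> alg m"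
        using assms by (intro alg.scale alg.mult alg_diff t) auto
      then show ?thesis
        by (rule bexI[rotated])
          (simp add: 1 t_def cnj_pow flip: diff_divide_distrib, simp add: power2_eq_square)
    next
      case 2
      have "(\<lambda>z. (- \<i> * c) * (t k 0 z * (t 0 0 z + t 0 (2 * m) z))) \<in> alg m"
        using assms by (intro alg.scale alg.mult alg.add t) auto
      then show ?thesis
        by (rule bexI[rotated])
          (simp add: 2 t_def cnj_pow flip: add_divide_distrib, simp add: power2_eq_square)
    next
      case 3
      have "(\<lambda>z. (2 * c) * (t k 0 z * t 0 m z)) \<in> alg m"
        using assms by (intro alg.scale alg.mult t) auto
      then show ?thesis
        by (rule bexI[rotated]) (simp add: 3 t_def power2_eq_square)
    qed
  qed
  then show "\<exists>f\<in>alg m. \<forall>z. tangent_field m (\<lambda>z. c * z ^ k) z $ i = Re (f z)"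
    unfolding tangent_field_def tangent_lift by metis
qed

lemma tangent_field_in_kernel:
  assumes "k \<le> 2 * m"
  shows "tangent_field m (\<lambda>z. c * z ^ k) \<in> bounded_kernel (U m)"
proof -
  let ?v = "tangent_field m (\<lambda>z. c * z ^ k)"
  have a: "alg_map m ?v" by (rule alg_map_tangent_field[OF assms])
  have tan: "?v z \<bullet> stereo (z ^ m) = 0" for z
    by (simp add: tangent_field_def tangent_lift_tangent)
  have "((\<lambda>z. null_form (z ^ m) (?v z)) has_field_derivative c * (of_nat k * z ^ (k - 1))) (at z)" for z
    unfolding tangent_field_def null_form_tangent_lift by (auto intro!: derivative_eq_intros)
  from pow.kernel_of_holomorphic[OF alg_map_C2[OF a] tan this]
  show ?thesis
    using alg_map_C2[OF a] alg_map_C2_bounded[OF a] tan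
    by (simp add: bounded_kernel_def U_eq_stereo)
qed

lemma kernel_eq_tangent_field:
  assumes m: "m \<ge> 1" and v: "v \<in> bounded_kernel (U m)"
  obtains a where "v = tangent_field m (\<lambda>z. \<Sum>k\<le>2 * m. a k * z ^ k)"
proof -
  have v': "v \<in> bounded_kernel (\<lambda>z. stereo (z ^ m))"
    using v by (simp add: U_eq_stereo)
  have "filterlim (\<lambda>z::complex. z ^ m) at_infinity at_infinity"
    using m by (intro filterlim_power_at_infinity filterlim_ident) auto
  note k = pow.bounded_kernel_holomorphic[OF v' this]
  let ?f = "\<lambda>z. null_form (z ^ m) (v z)"
  obtain B where B: "cmod (?f z) \<le> B * conf (z ^ m)" for z
    using k(2) by blast
  have "cmod (?f z) \<le> (2 * \<bar>B\<bar>) * cmod z ^ (2 * m)" if "1 \<le> cmod z" for z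
  proof -
    have "cmod (?f z) \<le> \<bar>B\<bar> * conf (z ^ m)"
      using B[of z] mult_right_mono[of B "\<bar>B\<bar>" "conf (z ^ m)"] conf_pos[of "z ^ m"] by linarith
    also have "conf (z ^ m) = 1 + cmod z ^ (2 * m)"
      by (simp add: conf_def norm_power power_mult mult.commute)
    also have "\<bar>B\<bar> * (1 + cmod z ^ (2 * m)) \<le> \<bar>B\<bar> * (2 * cmod z ^ (2 * m))"
      using one_le_power[OF that, of "2 * m"] by (intro mult_left_mono) auto
    finally show ?thesis by simp
  qed
  then have f: "?f z = (\<Sum>j\<le>2 * m. ((deriv ^^ j) ?f 0 / fact j) * z ^ j)" for z
    by (rule Liouville_polynomial[OF k(1)])
  have "v z = tangent_lift (z ^ m) (?f z)" for z
    using v' by (intro tangent_lift_null_form[symmetric]) (auto simp: bounded_kernel_def)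
  then have "v = tangent_field m (\<lambda>z. \<Sum>j\<le>2 * m. ((deriv ^^ j) ?f 0 / fact j) * z ^ j)"
    unfolding tangent_field_def f[symmetric] by blast
  then show thesis by (rule that)
qed

section \<open>The monomial fields form a basis\<close>

text \<open>The fields with coordinates \<open>z\<^sup>k\<close> and \<open>\<i> z\<^sup>k\<close>, \<open>k \<le> 2m\<close>.\<close>

definition monomial_fields :: "nat \<Rightarrow> map3 set"
  where "monomial_fields m = (\<lambda>(k, c). tangent_field m (\<lambda>z. c * z ^ k)) ` ({..2 * m} \<times> {1, \<i>})"

lemma tangent_field_monomial_in_span:
  assumes "k \<le> 2 * m"
  shows "tangent_field m (\<lambda>z. c * z ^ k) \<in> span (monomial_fields m)"
proof -
  have "c * z ^ k = complex_of_real (Re c) * (1 * z ^ k) + complex_of_real (Im c) * (\<i> * z ^ k)" for z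
    by (simp add: complex_eq_iff algebra_simps)
  then have "tangent_field m (\<lambda>z. c * z ^ k) =
      Re c *\<^sub>R tangent_field m (\<lambda>z. 1 * z ^ k) + Im c *\<^sub>R tangent_field m (\<lambda>z. \<i> * z ^ k)"
    by (simp only: tangent_field_add tangent_field_scaleR)
  moreover have "tangent_field m (\<lambda>z. 1 * z ^ k) \<in> monomial_fields m" "tangent_field m (\<lambda>z. \<i> * z ^ k) \<in> monomial_fields m"
    using assms unfolding monomial_fields_def by force+
  ultimately show ?thesis
    by (simp only: span_add span_scale span_base)
qed

lemma tangent_field_polynomial_in_span:
  assumes "n \<le> 2 * m"
  shows "tangent_field m (\<lambda>z. \<Sum>k\<le>n. a k * z ^ k) \<in> span (monomial_fields m)"
  using assms
proof (induction n)
  case 0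
  show ?case using tangent_field_monomial_in_span[of 0 m "a 0"] by simp
next
  case (Suc n)
  then show ?case
    unfolding sum.atMost_Suc tangent_field_add by (intro span_add tangent_field_monomial_in_span) auto
qed

lemma monomial_fields_independent: "independent (monomial_fields m)" and card_monomial_fields: "card (monomial_fields m) = 4 * m + 2"
proof -
  let ?I = "{..2 * m} \<times> {1, \<i>}" and ?g = "\<lambda>(k, c). tangent_field m (\<lambda>z. c * z ^ k)"
  have inj: "inj_on ?g ?I"
  proof (rule inj_onI)
    fix x y assume x: "x \<in> ?I" and y: "y \<in> ?I" and eq: "?g x = ?g y"
    obtain k c l d where xy: "x = (k, c)" "y = (l, d)" by force
    have "c * z ^ k = d * z ^ l" for z
      using arg_cong[OF fun_cong[OF eq, of z], of "null_form (z ^ m)"]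
      by (simp add: xy tangent_field_def null_form_tangent_lift)
    from this[of 1] this[of 2] have "c = d" "c * 2 ^ k = d * 2 ^ l" by simp_all
    moreover have "c \<noteq> 0" using x xy by auto
    ultimately have "(2::complex) ^ k = 2 ^ l" by simp
    then have "(2::nat) ^ k = 2 ^ l"
      by (metis of_nat_eq_iff of_nat_numeral of_nat_power)
    then show "x = y" using \<open>c = d\<close> by (simp add: xy)
  qed
  show "card (monomial_fields m) = 4 * m + 2"
    unfolding monomial_fields_def card_image[OF inj] by (simp add: card_cartesian_product complex_eq_iff)
  show "independent (monomial_fields m)"
  proof (rule independent_if_scalars_zero)
    show "finite (monomial_fields m)" by (simp add: monomial_fields_def)
    fix f x assume sum: "(\<Sum>x\<in>monomial_fields m. f x *\<^sub>R x) = 0" and x: "x \<in> monomial_fields m"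
    define a where "a k = complex_of_real (f (?g (k, 1))) + \<i> * f (?g (k, \<i>))" for k
    have eval: "(\<Sum>i\<in>A. h i) z = (\<Sum>i\<in>A. h i z)" for A and h :: "nat \<times> complex \<Rightarrow> map3" and z
      by (induction A rule: infinite_finite_induct) (simp_all add: zero_fun_def plus_fun_def)
    have "(\<Sum>k\<le>2 * m. a k * z ^ k) = 0" for z
    proof -
      have nsum: "null_form (z ^ m) (\<Sum>i\<in>A. h i) = (\<Sum>i\<in>A. null_form (z ^ m) (h i))"
        for A and h :: "nat \<times> complex \<Rightarrow> real^3"
        by (induction A rule: infinite_finite_induct) (simp_all add: null_form_add, simp_all add: null_form_def)
      have "0 = (\<Sum>i\<in>?I. f (?g i) *\<^sub>R ?g i)"
        using sum unfolding monomial_fields_def by (simp add: sum.reindex[OF inj] o_def)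
      then have "0 = (\<Sum>i\<in>?I. f (?g i) *\<^sub>R ?g i z)"
        using eval[of "\<lambda>i. f (?g i) *\<^sub>R ?g i" ?I z] by (metis (no_types, lifting) scaleR_fun_def sum.cong zero_fun_def)
      then have "null_form (z ^ m) 0 = null_form (z ^ m) (\<Sum>i\<in>?I. f (?g i) *\<^sub>R ?g i z)"
        by (rule arg_cong)
      also have "\<dots> = (\<Sum>i\<in>?I. f (?g i) * null_form (z ^ m) (?g i z))"
        by (simp only: nsum null_form_scaleR)
      also have "\<dots> = (\<Sum>(k, c)\<in>?I. f (?g (k, c)) * (c * z ^ k))"
        by (intro sum.cong) (auto simp: tangent_field_def null_form_tangent_lift)
      also have "\<dots> = (\<Sum>k\<le>2 * m. a k * z ^ k)"
        unfolding sum.cartesian_product[symmetric] a_def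
        by (simp add: complex_eq_iff[of 1 \<i>] algebra_simps)
      finally show ?thesis by (simp add: null_form_def)
    qed
    then have a0: "a k = 0" if "k \<le> 2 * m" for k
      using zero_polynom_imp_zero_coeffs that by blast
    obtain k c where kc: "k \<le> 2 * m" "c = 1 \<or> c = \<i>" "x = ?g (k, c)"
      using x by (auto simp: monomial_fields_def)
    have "f (?g (k, 1)) = 0 \<and> f (?g (k, \<i>)) = 0"
      using a0[OF kc(1)] by (simp add: a_def complex_eq_iff)
    then show "f x = 0"
      using kc(2,3) by blast
  qed
qed

section \<open>The explicit kernel maps\<close>

lemma eq_tangent_liftI: "x \<bullet> stereo w = 0 \<Longrightarrow> null_form w x = c \<Longrightarrow> x = tangent_lift w c"
  using tangent_lift_null_form by metis

text \<open>The moving frame in complex coordinates. Dividing by \<open>1 + r^(2m)\<close> makes the coordinates independent of \<open>r\<close>.\<close>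

lemma frame_eq_tangent_lift:
  "(1 / (1 + r ^ (2 * m))) *\<^sub>R E1 m t = tangent_lift (rcis r t ^ m) (\<i> * cis (m * t))"
  "(1 / (1 + r ^ (2 * m))) *\<^sub>R E2 m r t = tangent_lift (rcis r t ^ m) (- cis (m * t))"
proof -
  define R C S where "R = r ^ m" and "C = cos (m * t)" and "S = sin (m * t)"
  have CS: "C * C + S * S = 1"
    using sin_cos_squared_add3[of "m * t"] by (simp add: C_def S_def)
  have D: "1 + R\<^sup>2 > 0" "1 + R\<^sup>2 \<noteq> 0" by (simp_all add: add_pos_nonneg sum_power2_eq_zero_iff)
    (metis add_pos_nonneg less_irrefl zero_le_power2 zero_less_one)
  have r: "r ^ (2 * m) = R\<^sup>2" by (simp add: R_def power_mult mult.commute)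
  have w: "rcis r t ^ m = Complex (R * C) (R * S)" "cis (m * t) = Complex C S"
    by (simp_all add: complex_eq_iff rcis_power_Re_Im R_def C_def S_def)
  have sinQ: "sin (Q m r) = 2 * R / (1 + R\<^sup>2)" and cosQ: "cos (Q m r) = (R\<^sup>2 - 1) / (1 + R\<^sup>2)"
    using D unfolding Q_def R_def[symmetric]
    by (simp_all add: sin_double cos_double sin_arctan cos_arctan power_divide diff_divide_distrib)
  have scale: "(a *\<^sub>R x) \<bullet> y = 0" if "x \<bullet> y = 0" for a and x y :: "real^3"
    using that by simp
  show "(1 / (1 + r ^ (2 * m))) *\<^sub>R E1 m t = tangent_lift (rcis r t ^ m) (\<i> * cis (m * t))"
  proof (rule eq_tangent_liftI)
    show "(1 / (1 + r ^ (2 * m))) *\<^sub>R E1 m t \<bullet> stereo (rcis r t ^ m) = 0"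
      by (rule scale) (simp add: tangent_iff w E1_def C_def S_def)
    have "null_form (Complex (R * C) (R * S)) (vector [- S, C, 0]) = (1 + R\<^sup>2) * (\<i> * Complex C S)"
      using CS by (simp add: null_form_def complex_eq_iff power2_eq_square) algebra
    then show "null_form (rcis r t ^ m) ((1 / (1 + r ^ (2 * m))) *\<^sub>R E1 m t) = \<i> * cis (m * t)"
      using D unfolding null_form_scaleR r w E1_def C_def[symmetric] S_def[symmetric]
      by (simp add: of_real_eq_0_iff del: of_real_add of_real_power)
  qed
  have E2: "E2 m r t = (1 / (1 + R\<^sup>2)) *\<^sub>R vector [C * (R\<^sup>2 - 1), S * (R\<^sup>2 - 1), - (2 * R)]"
    by (simp add: E2_def sinQ cosQ vec_eq_iff forall_3 C_def S_def)
  show "(1 / (1 + r ^ (2 * m))) *\<^sub>R E2 m r t = tangent_lift (rcis r t ^ m) (- cis (m * t))"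
  proof (rule eq_tangent_liftI)
    show "(1 / (1 + r ^ (2 * m))) *\<^sub>R E2 m r t \<bullet> stereo (rcis r t ^ m) = 0"
    proof (unfold E2 w, intro scale, unfold tangent_iff)
      show "2 * Re (Complex (R * C) (R * S)) * vector [C * (R\<^sup>2 - 1), S * (R\<^sup>2 - 1), - (2 * R)] $ (1::3)
        + 2 * Im (Complex (R * C) (R * S)) * vector [C * (R\<^sup>2 - 1), S * (R\<^sup>2 - 1), - (2 * R)] $ (2::3)
        + ((Re (Complex (R * C) (R * S)))\<^sup>2 + (Im (Complex (R * C) (R * S)))\<^sup>2 - 1)
          * vector [C * (R\<^sup>2 - 1), S * (R\<^sup>2 - 1), - (2 * R)] $ (3::3) = 0"
        using CS by (simp add: power2_eq_square) algebra
    qed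
    have "null_form (Complex (R * C) (R * S)) (vector [C * (R\<^sup>2 - 1), S * (R\<^sup>2 - 1), - (2 * R)])
        = (1 + R\<^sup>2)\<^sup>2 * (- Complex C S)"
      using CS by (simp add: null_form_def complex_eq_iff power2_eq_square) algebra
    then show "null_form (rcis r t ^ m) ((1 / (1 + r ^ (2 * m))) *\<^sub>R E2 m r t) = - cis (m * t)"
      using D unfolding null_form_scaleR r w E2
      by (simp add: of_real_eq_0_iff power2_eq_square del: of_real_add of_real_power)
  qed
qed

lemma of_polar_frame:
  assumes "\<And>r t. (\<i> * a r t - b r t) * cis (m * t) = c * rcis r t ^ k"
    and "\<And>r t. f r t = (1 / (1 + r ^ (2 * m))) *\<^sub>R (a r t *\<^sub>R E1 m t + b r t *\<^sub>R E2 m r t)"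
  shows "of_polar f = tangent_field m (\<lambda>z. c * z ^ k)"
proof
  fix z
  define r t where "r = cmod z" and "t = Arg z"
  have z: "z = rcis r t" by (simp add: r_def t_def rcis_cmod_Arg)
  have "f r t = a r t *\<^sub>R tangent_lift (z ^ m) (\<i> * cis (m * t)) + b r t *\<^sub>R tangent_lift (z ^ m) (- cis (m * t))"
    unfolding assms(2) z frame_eq_tangent_lift[symmetric] by (simp add: scaleR_add_right)
  also have "\<dots> = tangent_lift (z ^ m) (a r t *\<^sub>R (\<i> * cis (m * t)) + b r t *\<^sub>R (- cis (m * t)))"
    by (simp only: linear_add[OF bounded_linear.linear[OF bounded_linear_tangent_lift]]
        linear_scale[OF bounded_linear.linear[OF bounded_linear_tangent_lift]])
  also have "a r t *\<^sub>R (\<i> * cis (m * t)) + b r t *\<^sub>R (- cis (m * t)) = c * z ^ k"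
    unfolding z assms(1)[symmetric] by (simp add: scaleR_conv_of_real algebra_simps)
  finally show "of_polar f z = tangent_field m (\<lambda>z. c * z ^ k) z"
    by (simp add: of_polar_def tangent_field_def r_def t_def)
qed

lemma Ek_eq_tangent_field:
  assumes "k \<le> m"
  shows "Ek1 m k = tangent_field m (\<lambda>z. - \<i> * z ^ (m - k))" "Ek2 m k = tangent_field m (\<lambda>z. - 1 * z ^ (m - k))"
proof -
  have pw: "rcis r t ^ (m - k) = complex_of_real (r ^ (m - k)) * (cis (- (k * t)) * cis (m * t))" for r t :: real
    unfolding DeMoivre2 unfolding rcis_def cis_mult using assms
    by (simp add: of_nat_diff algebra_simps)
  show "Ek1 m k = tangent_field m (\<lambda>z. - \<i> * z ^ (m - k))"
    unfolding Ek1_def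
  proof (rule of_polar_frame[where a = "\<lambda>r t. - (r ^ (m - k) * cos (k * t))" and b = "\<lambda>r t. r ^ (m - k) * sin (k * t)"])
    fix r t :: real
    have "\<i> * complex_of_real (- (r ^ (m - k) * cos (k * t))) - r ^ (m - k) * sin (k * t)
        = - \<i> * (r ^ (m - k) * cis (- (k * t)))"
      by (simp add: complex_eq_iff)
    then show "(\<i> * complex_of_real (- (r ^ (m - k) * cos (k * t))) - complex_of_real (r ^ (m - k) * sin (k * t)))
        * cis (m * t) = - \<i> * rcis r t ^ (m - k)"
      unfolding pw by (simp add: mult.assoc)
  qed (simp add: algebra_simps)
  show "Ek2 m k = tangent_field m (\<lambda>z. - 1 * z ^ (m - k))"
    unfolding Ek2_def
  proof (rule of_polar_frame[where a = "\<lambda>r t. r ^ (m - k) * sin (k * t)" and b = "\<lambda>r t. r ^ (m - k) * cos (k * t)"])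
    fix r t :: real
    have "\<i> * complex_of_real (r ^ (m - k) * sin (k * t)) - r ^ (m - k) * cos (k * t)
        = - 1 * (r ^ (m - k) * cis (- (k * t)))"
      by (simp add: complex_eq_iff)
    then show "(\<i> * complex_of_real (r ^ (m - k) * sin (k * t)) - complex_of_real (r ^ (m - k) * cos (k * t)))
        * cis (m * t) = - 1 * rcis r t ^ (m - k)"
      unfolding pw by (simp add: mult.assoc)
  qed (simp add: algebra_simps)
qed

lemma Etilde_eq_tangent_field:
  "Etilde1 m k = tangent_field m (\<lambda>z. - \<i> * z ^ (m + k))" "Etilde2 m k = tangent_field m (\<lambda>z. - 1 * z ^ (m + k))"
proof -
  have pw: "rcis r t ^ (m + k) = complex_of_real (r ^ (m + k)) * (cis (k * t) * cis (m * t))" for r t :: real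
    unfolding DeMoivre2 unfolding rcis_def cis_mult by (simp add: algebra_simps)
  show "Etilde1 m k = tangent_field m (\<lambda>z. - \<i> * z ^ (m + k))"
    unfolding Etilde1_def
  proof (rule of_polar_frame[where a = "\<lambda>r t. - (r ^ (m + k) * cos (k * t))" and b = "\<lambda>r t. - (r ^ (m + k) * sin (k * t))"])
    fix r t :: real
    have "\<i> * complex_of_real (- (r ^ (m + k) * cos (k * t))) - complex_of_real (- (r ^ (m + k) * sin (k * t)))
        = - \<i> * (r ^ (m + k) * cis (k * t))"
      by (simp add: complex_eq_iff)
    then show "(\<i> * complex_of_real (- (r ^ (m + k) * cos (k * t))) - complex_of_real (- (r ^ (m + k) * sin (k * t))))
        * cis (m * t) = - \<i> * rcis r t ^ (m + k)"
      unfolding pw by (simp add: mult.assoc)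
  qed (simp add: algebra_simps)
  show "Etilde2 m k = tangent_field m (\<lambda>z. - 1 * z ^ (m + k))"
    unfolding Etilde2_def
  proof (rule of_polar_frame[where a = "\<lambda>r t. - (r ^ (m + k) * sin (k * t))" and b = "\<lambda>r t. r ^ (m + k) * cos (k * t)"])
    fix r t :: real
    have "\<i> * complex_of_real (- (r ^ (m + k) * sin (k * t))) - complex_of_real (r ^ (m + k) * cos (k * t))
        = - 1 * (r ^ (m + k) * cis (k * t))"
      by (simp add: complex_eq_iff)
    then show "(\<i> * complex_of_real (- (r ^ (m + k) * sin (k * t))) - complex_of_real (r ^ (m + k) * cos (k * t)))
        * cis (m * t) = - 1 * rcis r t ^ (m + k)"
      unfolding pw by (simp add: mult.assoc)
  qed (simp add: algebra_simps)
qed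

text \<open>Unlike the other maps, these two have the non-monomial coordinates \<open>\<i> (z^(2m) - 1)\<close> and \<open>- (z^(2m) + 1)\<close>.\<close>

lemma Etilde_m_eq_tangent_field:
  "Etilde_m1 m = tangent_field m (\<lambda>z. \<i> * z ^ (2 * m)) - tangent_field m (\<lambda>z. \<i> * z ^ 0)"
  "Etilde_m2 m = - (tangent_field m (\<lambda>z. 1 * z ^ (2 * m)) + tangent_field m (\<lambda>z. 1 * z ^ 0))"
proof -
  have lin: "tangent_lift w (a - b) = tangent_lift w a - tangent_lift w b" "tangent_lift w (- (a + b)) = - (tangent_lift w a + tangent_lift w b)" for w a b
    using bounded_linear.linear[OF bounded_linear_tangent_lift] by (simp_all add: linear_diff linear_add linear_neg)
  have main: "Etilde_m1 m z = tangent_lift (z ^ m) (\<i> * ((z ^ m)\<^sup>2 - 1)) \<and> Etilde_m2 m z = tangent_lift (z ^ m) (- ((z ^ m)\<^sup>2 + 1))" for z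
  proof -
    define w where "w = z ^ m"
    have z: "rcis (cmod z) (Arg z) = z" by (rule rcis_cmod_Arg)
    have wn: "cmod z ^ (2 * m) = (cmod w)\<^sup>2"
      by (simp add: w_def norm_power power_mult mult.commute)
    have wc: "cmod z ^ m * cos (m * Arg z) = Re w" "cmod z ^ m * sin (m * Arg z) = Im w"
      using rcis_power_Re_Im[of "cmod z" "Arg z" m] unfolding z w_def by simp_all
    have 1: "Etilde_m1 m z = (1 / conf w) *\<^sub>R vector [0, (Re w)\<^sup>2 + (Im w)\<^sup>2 - 1, - (2 * Im w)]"
      by (simp add: Etilde_m1_def of_polar_def wn mult.assoc wc vec_eq_iff forall_3 conf_def cmod_power2 add.commute)
    have 2: "Etilde_m2 m z = (1 / conf w) *\<^sub>R vector [(Re w)\<^sup>2 + (Im w)\<^sup>2 - 1, 0, - (2 * Re w)]"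
      by (simp add: Etilde_m2_def of_polar_def wn mult.assoc wc vec_eq_iff forall_3 conf_def cmod_power2 add.commute)
    have n1: "null_form w (vector [0, (Re w)\<^sup>2 + (Im w)\<^sup>2 - 1, - (2 * Im w)]) = conf w * (\<i> * (w\<^sup>2 - 1))"
      by (simp add: null_form_def conf_eq complex_eq_iff power2_eq_square algebra_simps)
    have n2: "null_form w (vector [(Re w)\<^sup>2 + (Im w)\<^sup>2 - 1, 0, - (2 * Re w)]) = conf w * (- (w\<^sup>2 + 1))"
      by (simp add: null_form_def conf_eq complex_eq_iff power2_eq_square algebra_simps)
    have scale: "(a *\<^sub>R x) \<bullet> y = 0" if "x \<bullet> y = 0" for a and x y :: "real^3"
      using that by simp
    have "Etilde_m1 m z = tangent_lift w (\<i> * (w\<^sup>2 - 1))"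
      by (rule eq_tangent_liftI; unfold 1)
        (intro scale, simp add: tangent_iff algebra_simps, simp add: null_form_scaleR n1)
    moreover have "Etilde_m2 m z = tangent_lift w (- (w\<^sup>2 + 1))"
      by (rule eq_tangent_liftI; unfold 2)
        (intro scale, simp add: tangent_iff algebra_simps, simp add: null_form_scaleR n2)
    ultimately show ?thesis by (simp add: w_def)
  qed
  have p: "z ^ (2 * m) = (z ^ m)\<^sup>2" for z :: complex
    by (simp add: power_mult mult.commute)
  show "Etilde_m1 m = tangent_field m (\<lambda>z. \<i> * z ^ (2 * m)) - tangent_field m (\<lambda>z. \<i> * z ^ 0)"
    "Etilde_m2 m = - (tangent_field m (\<lambda>z. 1 * z ^ (2 * m)) + tangent_field m (\<lambda>z. 1 * z ^ 0))"
    by (simp_all only: fun_eq_iff fun_diff_def uminus_apply plus_fun_def tangent_field_def main p lin[symmetric])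
      (simp_all add: algebra_simps)
qed

lemma monomial_fields_subset_span:
  assumes "m \<ge> 1"
  shows "monomial_fields m \<subseteq> span (kernel_maps m)"
proof
  fix x assume "x \<in> monomial_fields m"
  then obtain k c where k: "k \<le> 2 * m" and c: "c = 1 \<or> c = \<i>" and x: "x = tangent_field m (\<lambda>z. c * z ^ k)"
    by (auto simp: monomial_fields_def)
  have neg: "tangent_field m (\<lambda>z. c * z ^ j) \<in> span (kernel_maps m)"
    if "tangent_field m (\<lambda>z. - c * z ^ j) \<in> kernel_maps m" for c j
  proof -
    have "tangent_field m (\<lambda>z. complex_of_real (- 1) * (- c * z ^ j)) = (- 1) *\<^sub>R tangent_field m (\<lambda>z. - c * z ^ j)"
      by (rule tangent_field_scaleR)
    then show ?thesis
      using span_scale[OF span_base[OF that], of "- 1"] by simp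
  qed
  have low: "tangent_field m (\<lambda>z. \<i> * z ^ j) \<in> span (kernel_maps m)" "tangent_field m (\<lambda>z. 1 * z ^ j) \<in> span (kernel_maps m)"
    if "j < 2 * m" for j
  proof -
    have "tangent_field m (\<lambda>z. - \<i> * z ^ j) \<in> kernel_maps m \<and> tangent_field m (\<lambda>z. - 1 * z ^ j) \<in> kernel_maps m"
    proof (cases "j \<le> m")
      case True
      then have "Ek1 m (m - j) = tangent_field m (\<lambda>z. - \<i> * z ^ j)" "Ek2 m (m - j) = tangent_field m (\<lambda>z. - 1 * z ^ j)"
        using Ek_eq_tangent_field[of "m - j" m] by simp_all
      moreover have "Ek1 m (m - j) \<in> kernel_maps m" "Ek2 m (m - j) \<in> kernel_maps m"
        by (auto simp: kernel_maps_def)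
      ultimately show ?thesis by simp
    next
      case False
      then have "Etilde1 m (j - m) = tangent_field m (\<lambda>z. - \<i> * z ^ j)" "Etilde2 m (j - m) = tangent_field m (\<lambda>z. - 1 * z ^ j)"
        using Etilde_eq_tangent_field[of m "j - m"] by simp_all
      moreover have "j - m \<in> {1..<m}"
        using False that by auto
      then have "Etilde1 m (j - m) \<in> kernel_maps m" "Etilde2 m (j - m) \<in> kernel_maps m"
        unfolding kernel_maps_def by blast+
      ultimately show ?thesis by simp
    qed
    then show "tangent_field m (\<lambda>z. \<i> * z ^ j) \<in> span (kernel_maps m)" "tangent_field m (\<lambda>z. 1 * z ^ j) \<in> span (kernel_maps m)"
      using neg by blast+
  qed
  have 0: "0 < 2 * m" using assms by simp
  have top: "Etilde_m1 m \<in> span (kernel_maps m)" "Etilde_m2 m \<in> span (kernel_maps m)"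
    by (auto intro!: span_base simp: kernel_maps_def)
  have eq: "tangent_field m (\<lambda>z. \<i> * z ^ (2 * m)) = Etilde_m1 m + tangent_field m (\<lambda>z. \<i> * z ^ 0)"
    "tangent_field m (\<lambda>z. 1 * z ^ (2 * m)) = - (Etilde_m2 m + tangent_field m (\<lambda>z. 1 * z ^ 0))"
    unfolding Etilde_m_eq_tangent_field by simp_all
  show "x \<in> span (kernel_maps m)"
  proof (cases "k = 2 * m")
    case True
    then show ?thesis
      using c unfolding x by (elim disjE) (simp_all only: eq span_add span_neg low[OF 0] top)
  next
    case False
    then have "k < 2 * m" using k by simp
    then show ?thesis using c low unfolding x by blast
  qed
qed

theorem corollary1p1:
  fixes m :: nat
  assumes "m \<ge> 1"
  shows "bounded_kernel (U m) \<subseteq> span (kernel_maps m) \<and> dim (bounded_kernel (U m)) = 4 * m + 2"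
proof
  have sub: "bounded_kernel (U m) \<subseteq> span (monomial_fields m)"
    using kernel_eq_tangent_field[OF assms] tangent_field_polynomial_in_span[OF order_refl] by (metis subsetI)
  also have "\<dots> \<subseteq> span (kernel_maps m)"
    using monomial_fields_subset_span[OF assms] by (rule span_minimal[OF _ subspace_span])
  finally show "bounded_kernel (U m) \<subseteq> span (kernel_maps m)" .
  have "monomial_fields m \<subseteq> bounded_kernel (U m)"
    using tangent_field_in_kernel by (auto simp: monomial_fields_def)
  then show "dim (bounded_kernel (U m)) = 4 * m + 2"
    using sub monomial_fields_independent card_monomial_fields by (rule dim_unique)
qed

end
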